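(* Let $f:\mathbb{R}^n\to\mathbb{R}$ be convex and $L$-smooth ($L>0$), with a minimizer $x^*$ and $f^*=f(x^* )$. Let $\{x_k\}_{k\ge0}$ be generated from a deterministic initialization $x_0=x_1\in\mathbb{R}^n$ by $$x_{k+1}=x_k+\frac{k}{k+2}(x_k-x_{k-1})-\frac{2\sqrt{\eta_k}}{(k+2)\sqrt{k}}\,g(x_k,\xi_k),\qquad k\ge1,$$ with stepsize $\eta_k=\frac{1}{16L^2\log^2(k+2)}$. Let $\mathcal{F}_k=\sigma(\xi_1,\dots,\xi_{k-1})$ and suppose that, for some $\sigma>0$ and every $k\ge1$, $$\mathbb{E}[g(x_k,\xi_k)\mid\mathcal{F}_k]=\nabla f(x_k),\qquad \mathbb{E}[\|g(x_k,\xi_k)\|^2\mid\mathcal{F}_k]\le\|\nabla f(x_k)\|^2+\sigma^2,$$ $$\mathbb{E}\left[\exp\left(\frac{\|g(x_k,\xi_k)-\nabla f(x_k)\|^2}{\sigma^2}\right)\Big|\,\mathcal{F}_k\right]\le\exp(1).$$ Then for any $\beta>0$, $$\mathbb{P}\left(f(x_k)-f^*\le\frac{\left(C_1+C_2\log\frac1\beta\right)\log(k+2)}{\sqrt{k+1}}\ \text{ for all } k\ge0\right)\ge1-2\beta,$$ where $C_1=L\gamma_2\mathcal{E}(0)+L\sigma^2(1+\sigma^2\gamma_1\gamma_2)\gamma_1$, $C_2=L\gamma_2+L\sigma^2(1+\sigma^2\gamma_1\gamma_2)\gamma_1$, $\gamma_1=\sum_{k=1}^\infty\frac{16\eta_k}{k}$,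 $\gamma_2=\prod_{k=1}^\infty\left(1+\frac{16\eta_k}{k}\sigma^2\right)$, and $\mathcal{E}(0)=\|x_1+(x_1-x_0)-x^*\|^2+4\sqrt{\eta_0}\,(f(x_0)-f^* )$.
   Context: $\|\cdot\|$ is the Euclidean norm. $f$ is $L$-smooth if it is differentiable and $\|\nabla f(x)-\nabla f(y)\|\le L\|x-y\|$ for all $x,y\in\mathbb{R}^n$. $g(x,\xi)$ is the output of a stochastic gradient oracle queried at $x$ with randomness $\xi$; $\mathcal{F}_k$ is the $\sigma$-algebra generated by all randomness after arriving at $x_k$. $\log$ is the natural logarithm and $\log^2(k+2)=(\log(k+2))^2$. The quantity $\mathcal{E}(0)$ is the value at $k=0$ of the Lyapunov function $\mathcal{E}(k)=\|x_{k+1}+(k+1)(x_{k+1}-x_k)-x^*\|^2+4\sqrt{(k+1)\eta_k}(f(x_k)-f^* )$. *)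

theory Defs
  imports "HOL-Probability.Probability"
begin

definition grad :: "('a::real_inner \<Rightarrow> real) \<Rightarrow> 'a \<Rightarrow> 'a" where
  "grad f x = (THE v. GDERIV f x :> v)"

lemma GDERIV_grad:
  fixes f :: "'a::euclidean_space \<Rightarrow> real"
  assumes "f differentiable (at x)"
  shows "GDERIV f x :> grad f x"
proof -
  obtain D where D: "(f has_derivative D) (at x)"
    using assms by (auto simp: differentiable_def)
  then have "D = (\<lambda>h. inner h (adjoint D 1))"
    using adjoint_works[of D _ 1] has_derivative_linear by fastforce
  with D have ex: "GDERIV f x :> adjoint D 1"
    unfolding gderiv_def by simp
  have uniq: "w = v" if v: "GDERIV f x :> v" and w: "GDERIV f x :> w" for v w
  proof -
    have "(\<lambda>h. inner h w) = (\<lambda>h. inner h v)"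
      using v w unfolding gderiv_def by (metis has_derivative_unique)
    then have "\<And>h. inner h w = inner h v"
      by meson
    then show ?thesis
      by (metis vector_eq_ldot)
  qed
  show ?thesis
    unfolding grad_def by (rule theI) (fact ex, rule uniq[OF ex])
qed

definition smooth_fun :: "real \<Rightarrow> ('a::real_inner \<Rightarrow> real) \<Rightarrow> bool" where
  "smooth_fun L f \<longleftrightarrow>
     (\<forall>x. f differentiable (at x)) \<and>
     (\<forall>x y. norm (grad f x - grad f y) \<le> L * norm (x - y))"

definition stepsize :: "real \<Rightarrow> nat \<Rightarrow> real" where
  "stepsize L k = 1 / (16 * L\<^sup>2 * (ln (real k + 2))\<^sup>2)"

text \<open>The sum and the product range over indices at least 1, hence the shift to \<^term>\<open>Suc j\<close>.\<close>

definition gamma1 :: "real \<Rightarrow> real" where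
  "gamma1 L = (\<Sum>j. 16 * stepsize L (Suc j) / real (Suc j))"

definition gamma2 :: "real \<Rightarrow> real \<Rightarrow> real" where
  "gamma2 L \<sigma> = prodinf (\<lambda>j. 1 + 16 * stepsize L (Suc j) / real (Suc j) * \<sigma>\<^sup>2)"

definition lyapunov_init :: "real \<Rightarrow> ('a::real_normed_vector \<Rightarrow> real) \<Rightarrow> 'a \<Rightarrow> 'a \<Rightarrow> 'a \<Rightarrow> real" where
  "lyapunov_init L f xstar x0 x1 =
     (norm (x1 + (x1 - x0) - xstar))\<^sup>2 + 4 * sqrt (stepsize L 0) * (f x0 - f xstar)"

definition const1 :: "real \<Rightarrow> real \<Rightarrow> real \<Rightarrow> real" where
  "const1 L \<sigma> E0 =
     L * gamma2 L \<sigma> * E0 + L * \<sigma>\<^sup>2 * (1 + \<sigma>\<^sup>2 * gamma1 L * gamma2 L \<sigma>) * gamma1 L"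

definition const2 :: "real \<Rightarrow> real \<Rightarrow> real" where
  "const2 L \<sigma> =
     L * gamma2 L \<sigma> + L * \<sigma>\<^sup>2 * (1 + \<sigma>\<^sup>2 * gamma1 L * gamma2 L \<sigma>) * gamma1 L"

text \<open>The \<sigma>-algebra generated by the samples with indices \<open>1, \<dots>, k - 1\<close>;
  for \<open>k \<le> 1\<close> it is trivial.\<close>

definition past :: "'w measure \<Rightarrow> 'b measure \<Rightarrow> (nat \<Rightarrow> 'w \<Rightarrow> 'b) \<Rightarrow> nat \<Rightarrow> 'w measure" where
  "past M N \<xi> k =
     sigma (space M) (\<Union>i\<in>{1..<k}. {\<xi> i -` A \<inter> space M | A. A \<in> sets N})"

text \<open>The library only conditions scalar functions, so vectors are conditioned componentwise.\<close>

definition vec_cond_exp ::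
  "'w measure \<Rightarrow> 'w measure \<Rightarrow> ('w \<Rightarrow> real ^ 'n) \<Rightarrow> 'w \<Rightarrow> real ^ 'n" where
  "vec_cond_exp M F X \<omega> = (\<chi> i. real_cond_exp M F (\<lambda>\<omega>'. X \<omega>' $ i) \<omega>)"

end

theory Submission
  imports Defs
begin

text \<open>
  Put \<open>z\<^sub>n = x\<^sub>n\<^sub>+\<^sub>1 + (n + 1) (x\<^sub>n\<^sub>+\<^sub>1 - x\<^sub>n) - x\<^sup>*\<close>, the vector in the Lyapunov function, and let
  \<open>e\<^sub>n\<close> be the oracle error (sample minus gradient) in the step from \<open>x\<^sub>n\<^sub>+\<^sub>1\<close>. The momentum
  coefficients are chosen such that \<open>z\<^sub>n\<^sub>+\<^sub>1 - z\<^sub>n\<close> is a multiple of the sampled gradient.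
  Expanding the square, and using convexity together with the inequality
  \<open>f x - f x\<^sup>* + \<parallel>\<nabla>f x\<parallel>\<^sup>2 / (2L) \<le> \<langle>\<nabla>f x, x - x\<^sup>*\<rangle>\<close> to absorb the term in \<open>\<parallel>\<nabla>f\<parallel>\<^sup>2\<close>, one gets for the
  Lyapunov values \<open>E\<^sub>n\<close> and the weights \<open>h\<^sub>n = 16 \<eta>\<^sub>n\<^sub>+\<^sub>1 / (n + 1)\<close> (lemma \<open>lyapunov_step\<close>)

    \<open>E\<^sub>n\<^sub>+\<^sub>1 \<le> E\<^sub>n + h\<^sub>n \<parallel>e\<^sub>n\<parallel>\<^sup>2 - \<surd>h\<^sub>n \<langle>e\<^sub>n, z\<^sub>n\<rangle>\<close>.

  The last term is a martingale difference whose size is controlled by the Lyapunov function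
  itself, because \<open>\<parallel>z\<^sub>n\<parallel>\<^sup>2 \<le> E\<^sub>n\<close>. A centred subgaussian vector \<open>e\<close> satisfies
  \<open>\<E>[exp (\<langle>e, v\<rangle> - \<sigma>\<^sup>2 \<parallel>v\<parallel>\<^sup>2) | past] \<le> 1\<close> for every predictable \<open>v\<close>
  (\<open>nn_cond_exp_exp_inner_le_1\<close>). If \<open>E\<^sub>n\<close> is discounted by \<open>\<Gamma>\<^sub>n = (\<Prod>j<n. 1 + \<sigma>\<^sup>2 h\<^sub>j)\<close>, the variance
  proxy of the martingale difference is paid for by the decrease of \<open>1 / \<Gamma>\<^sub>n\<close>
  (\<open>discounted_lyapunov_step\<close>), so with \<open>T\<^sub>n = (\<Sum>j<n. h\<^sub>j \<parallel>e\<^sub>j\<parallel>\<^sup>2)\<close> the process \<open>exp (E\<^sub>n / \<Gamma>\<^sub>n - T\<^sub>n)\<close> is a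
  supermartingale. Likewise \<open>exp (\<Sum>j<n. (h\<^sub>j / \<gamma>\<^sub>1) (\<parallel>e\<^sub>j\<parallel>\<^sup>2 / \<sigma>\<^sup>2 - 1))\<close> is a supermartingale, by the
  convexity of the exponential function.

  The maximal inequality for nonnegative supermartingales bounds each of them for all \<open>n\<close>
  simultaneously, each time outside an event of probability at most \<open>\<beta>\<close>. Let \<open>\<beta> < 1 / 2\<close>, as there is
  nothing to prove otherwise; then \<open>ln (1 / \<beta>)\<close> is positive. Off both events,
  \<open>E\<^sub>n \<le> \<Gamma>\<^sub>n (E\<^sub>0 + ln (1 / \<beta>) + T\<^sub>n)\<close> and \<open>T\<^sub>n \<le> \<sigma>\<^sup>2 \<gamma>\<^sub>1 (1 + ln (1 / \<beta>))\<close>. The stated constants follow by bounding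
  \<open>\<Gamma>\<^sub>n\<close> once by \<open>\<gamma>\<^sub>2\<close> and once by \<open>1 + \<sigma>\<^sup>2 \<gamma>\<^sub>1 \<gamma>\<^sub>2\<close>. Finally, \<open>f (x\<^sub>n) - f x\<^sup>*\<close> is at most
  \<open>L E\<^sub>n ln (n + 2) / \<surd>(n + 1)\<close>, because the Lyapunov function contains it with the inverse factor.
\<close>

section \<open>Convex smooth functions\<close>

lemma smooth_fun_gderiv:
  fixes f :: "'a::euclidean_space \<Rightarrow> real"
  assumes "smooth_fun L f"
  shows "GDERIV f x :> grad f x"
  using assms GDERIV_grad unfolding smooth_fun_def by blast

lemma GDERIV_along_line:
  fixes f :: "'a::real_inner \<Rightarrow> real"
  assumes "GDERIV f (x + t *\<^sub>R h) :> v"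
  shows "((\<lambda>s. f (x + s *\<^sub>R h)) has_real_derivative h \<bullet> v) (at t)"
proof -
  have "((\<lambda>s. x + s *\<^sub>R h) has_derivative (\<lambda>s. s *\<^sub>R h)) (at t)"
    by (auto intro!: derivative_eq_intros)
  moreover have "(f has_derivative (\<lambda>h. h \<bullet> v)) (at (x + t *\<^sub>R h))"
    using assms unfolding gderiv_def .
  ultimately have "(f \<circ> (\<lambda>s. x + s *\<^sub>R h) has_derivative (\<lambda>h. h \<bullet> v) \<circ> (\<lambda>s. s *\<^sub>R h)) (at t)"
    by (rule diff_chain_at)
  moreover have "(\<lambda>h. h \<bullet> v) \<circ> (\<lambda>s. s *\<^sub>R h) = (*) (h \<bullet> v)"
    by (auto simp: fun_eq_iff)
  ultimately show ?thesis
    by (simp add: has_field_derivative_def o_def)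
qed

lemma convex_gradient_lower_bound:
  fixes f :: "'a::real_inner \<Rightarrow> real"
  assumes "convex_on UNIV f" "GDERIV f x :> v"
  shows "f x + (y - x) \<bullet> v \<le> f y"
proof -
  define \<phi> where "\<phi> t = f (x + t *\<^sub>R (y - x))" for t
  have "convex_on UNIV \<phi>"
  proof (rule convex_onI)
    fix t a b :: real
    assume "0 < t" "t < 1"
    have "x + ((1 - t) *\<^sub>R a + t *\<^sub>R b) *\<^sub>R (y - x)
        = (1 - t) *\<^sub>R (x + a *\<^sub>R (y - x)) + t *\<^sub>R (x + b *\<^sub>R (y - x))"
      by (simp add: algebra_simps)
    then show "\<phi> ((1 - t) *\<^sub>R a + t *\<^sub>R b) \<le> (1 - t) * \<phi> a + t * \<phi> b"
      unfolding \<phi>_def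
      using convex_onD[OF assms(1), of t "x + a *\<^sub>R (y - x)" "x + b *\<^sub>R (y - x)"] \<open>0 < t\<close> \<open>t < 1\<close>
      by simp
  qed simp
  moreover have "(\<phi> has_real_derivative (y - x) \<bullet> v) (at 0)"
    unfolding \<phi>_def by (rule GDERIV_along_line) (simp add: assms(2))
  ultimately have "\<phi> 1 - \<phi> 0 \<ge> ((y - x) \<bullet> v) * (1 - 0)"
    by (intro convex_on_imp_above_tangent[where A = UNIV]) auto
  then show ?thesis
    by (simp add: \<phi>_def)
qed

text \<open>Along a segment, the difference between \<open>f\<close> and the quadratic model has a nonpositive derivative,
  because the gradient is Lipschitz.\<close>

lemma smooth_fun_upper_bound:
  fixes f :: "'a::euclidean_space \<Rightarrow> real"
  assumes "smooth_fun L f"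
  shows "f (x + h) \<le> f x + h \<bullet> grad f x + L / 2 * (norm h)\<^sup>2"
proof -
  define \<phi> where "\<phi> t = f (x + t *\<^sub>R h) - t * (h \<bullet> grad f x) - L / 2 * (norm h)\<^sup>2 * t\<^sup>2" for t
  have "\<phi> 1 \<le> \<phi> 0"
  proof (rule DERIV_nonpos_imp_nonincreasing[where f = \<phi>])
    fix t :: real
    assume t: "0 \<le> t" "t \<le> 1"
    let ?D = "h \<bullet> grad f (x + t *\<^sub>R h) - h \<bullet> grad f x - L * (norm h)\<^sup>2 * t"
    have "(\<phi> has_real_derivative ?D) (at t)"
      unfolding \<phi>_def
      by (auto intro!: derivative_eq_intros GDERIV_along_line smooth_fun_gderiv[OF assms])
    moreover have "?D \<le> 0"
    proof -
      have lipschitz: "norm (grad f (x + t *\<^sub>R h) - grad f x) \<le> L * norm (x + t *\<^sub>R h - x)"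
        using assms unfolding smooth_fun_def by blast
      have "h \<bullet> (grad f (x + t *\<^sub>R h) - grad f x) \<le> norm h * norm (grad f (x + t *\<^sub>R h) - grad f x)"
        by (rule norm_cauchy_schwarz)
      also have "\<dots> \<le> norm h * (L * norm (x + t *\<^sub>R h - x))"
        using lipschitz by (rule mult_left_mono) simp
      also have "\<dots> = L * (norm h)\<^sup>2 * t"
        using t by (simp add: power2_eq_square)
      finally show ?thesis
        by (simp add: inner_diff_right)
    qed
    ultimately show "\<exists>y. DERIV \<phi> t :> y \<and> y \<le> 0"
      by blast
  qed simp
  then show ?thesis
    by (simp add: \<phi>_def)
qed

lemma grad_minimizer_eq_0:
  fixes f :: "'a::euclidean_space \<Rightarrow> real"
  assumes "smooth_fun L f" "\<And>y. f xstar \<le> f y"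
  shows "grad f xstar = 0"
proof -
  have "(f has_derivative (\<lambda>h. h \<bullet> grad f xstar)) (at xstar)"
    using smooth_fun_gderiv[OF assms(1)] by (simp add: gderiv_def)
  then have "(\<lambda>h. h \<bullet> grad f xstar) = (\<lambda>h. 0)"
    by (rule has_derivative_local_min) (simp add: assms(2))
  then show ?thesis
    by (metis inner_eq_zero_iff)
qed

text \<open>The additional \<open>\<parallel>\<nabla>f x\<parallel>\<^sup>2\<close> over plain convexity comes from testing the tangent plane at \<open>x\<close> not at
  the minimizer but at the minimizer shifted by \<open>\<nabla>f x / L\<close>: there the plane is higher by
  \<open>\<parallel>\<nabla>f x\<parallel>\<^sup>2 / L\<close> than at the minimizer, while smoothness lets \<open>f\<close> rise above its minimum
  by at most half as much.\<close>

lemma inner_grad_ge_suboptimality: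
  fixes f :: "'a::euclidean_space \<Rightarrow> real"
  assumes "L > 0" "convex_on UNIV f" "smooth_fun L f" "\<And>y. f xstar \<le> f y"
  shows "f x - f xstar + (norm (grad f x))\<^sup>2 / (2 * L) \<le> (x - xstar) \<bullet> grad f x"
proof -
  define v where "v = grad f x"
  define w where "w = xstar + (1 / L) *\<^sub>R v"
  have "f x + (w - x) \<bullet> v \<le> f w"
    unfolding v_def by (intro convex_gradient_lower_bound smooth_fun_gderiv[OF assms(3)] assms)
  moreover have "f w \<le> f xstar + L / 2 * (norm ((1 / L) *\<^sub>R v))\<^sup>2"
    unfolding w_def using smooth_fun_upper_bound[OF assms(3), of xstar "(1 / L) *\<^sub>R v"]
    by (simp add: grad_minimizer_eq_0[OF assms(3,4)])
  moreover have "L / 2 * (norm ((1 / L) *\<^sub>R v))\<^sup>2 = (norm v)\<^sup>2 / (2 * L)"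
    using \<open>L > 0\<close> by (simp add: power_mult_distrib power2_eq_square field_simps)
  moreover have "(w - x) \<bullet> v = (norm v)\<^sup>2 / L - (x - xstar) \<bullet> v"
    by (simp add: w_def inner_add_left inner_diff_left power2_norm_eq_inner)
  moreover have "(norm v)\<^sup>2 / L = (norm v)\<^sup>2 / (2 * L) + (norm v)\<^sup>2 / (2 * L)"
    by simp
  ultimately show ?thesis
    unfolding v_def[symmetric] by linarith
qed

section \<open>Step sizes and their sum and product\<close>

lemma one_le_ln_add_2: "1 \<le> ln (real k + 2)" if "k \<ge> 1"
proof -
  have "exp 1 \<le> (3::real)"
    by (rule exp_le)
  then have "1 \<le> ln (3::real)"
    by (simp add: ln_ge_iff)
  also have "\<dots> \<le> ln (real k + 2)"
    using that by simp
  finally show ?thesis .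
qed

lemma sqrt_stepsize:
  assumes "L > 0"
  shows "sqrt (stepsize L k) = 1 / (4 * L * ln (real k + 2))"
proof -
  have "stepsize L k = (1 / (4 * L * ln (real k + 2)))\<^sup>2"
    by (simp add: stepsize_def power_mult_distrib power_divide)
  moreover have "1 / (4 * L * ln (real k + 2)) \<ge> 0"
    using assms by simp
  ultimately show ?thesis
    by simp
qed

lemma stepsize_pos: "L > 0 \<Longrightarrow> stepsize L k > 0"
  by (simp add: stepsize_def)

lemma stepsize_antimono:
  assumes "L > 0"
  shows "stepsize L (Suc k) \<le> stepsize L k"
proof -
  have "(ln (real k + 2))\<^sup>2 \<le> (ln (real (Suc k) + 2))\<^sup>2"
    by (intro power_mono) auto
  then show ?thesis
    using assms by (auto simp: stepsize_def intro!: divide_left_mono mult_pos_pos)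
qed

text \<open>The index is shifted: weight \<open>j\<close> belongs to iteration \<open>j + 1\<close>, so that \<open>\<gamma>\<^sub>1\<close> and \<open>\<gamma>\<^sub>2\<close> become a series
  and a product over all natural numbers.\<close>

definition noise_weight :: "real \<Rightarrow> nat \<Rightarrow> real" where
  "noise_weight L j = 16 * stepsize L (Suc j) / real (Suc j)"

lemma noise_weight_pos: "L > 0 \<Longrightarrow> noise_weight L j > 0"
  by (simp add: noise_weight_def stepsize_pos)

text \<open>The terms \<open>1 / (n ln\<^sup>2 n)\<close> are dominated by the telescoping differences of \<open>1 / ln n\<close>.\<close>

lemma summable_noise_weight:
  assumes "L > 0"
  shows "summable (noise_weight L)"
proof (rule summable_comparison_test')
  define c where "c n = 1 / ln (real n + 2)" for n
  have "c \<longlonglongrightarrow> 0"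
  proof -
    have "filterlim (\<lambda>n. real n + 2) at_top sequentially"
      using filterlim_tendsto_add_at_top[OF tendsto_const filterlim_real_sequentially, of 2]
      by (simp add: add.commute)
    then have "filterlim (\<lambda>n. ln (real n + 2)) at_top sequentially"
      by (rule filterlim_compose[OF ln_at_top])
    then show ?thesis
      unfolding c_def
      by (intro tendsto_divide_0[OF tendsto_const] filterlim_at_top_imp_at_infinity)
  qed
  then show "summable (\<lambda>n. 3 / L\<^sup>2 * (c n - c (Suc n)))"
    by (intro summable_mult telescope_summable')
  fix n :: nat
  define a b where "a = ln (real n + 2)" and "b = ln (real n + 3)"
  have a: "a > 0" and ab: "a \<le> b"
    by (simp_all add: a_def b_def)
  have "ln (real n + 2) - ln (real n + 3) \<le> ((real n + 2) - (real n + 3)) / (real n + 3)"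
    by (rule ln_diff_le) simp_all
  then have d: "b - a \<ge> 1 / (real n + 3)"
    by (simp add: a_def b_def)
  have "1 / ((real n + 1) * b\<^sup>2) \<le> 3 / ((real n + 3) * b\<^sup>2)"
    using a ab by (simp add: divide_simps)
  also have "\<dots> = 3 * (1 / (real n + 3)) / b\<^sup>2"
    by simp
  also have "\<dots> \<le> 3 * (b - a) / b\<^sup>2"
    using d by (intro divide_right_mono mult_left_mono) auto
  also have "\<dots> \<le> 3 * (b - a) / (a * b)"
    using a ab by (intro divide_left_mono) (auto simp: power2_eq_square)
  also have "\<dots> = 3 * (c n - c (Suc n))"
    using a ab by (simp add: c_def a_def b_def field_simps)
  finally have "1 / ((real n + 1) * b\<^sup>2) / L\<^sup>2 \<le> 3 * (c n - c (Suc n)) / L\<^sup>2"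
    by (rule divide_right_mono) simp
  moreover have "norm (noise_weight L n) = 1 / ((real n + 1) * b\<^sup>2) / L\<^sup>2"
    using noise_weight_pos[OF assms, of n]
    by (simp add: noise_weight_def stepsize_def b_def field_simps)
  ultimately show "norm (noise_weight L n) \<le> 3 / L\<^sup>2 * (c n - c (Suc n))"
    by simp
qed

lemma gamma1_eq_suminf: "gamma1 L = suminf (noise_weight L)"
  by (simp add: gamma1_def noise_weight_def[abs_def])

lemma sum_noise_weight_le_gamma1:
  assumes "L > 0"
  shows "(\<Sum>j<n. noise_weight L j) \<le> gamma1 L"
  unfolding gamma1_eq_suminf
  using noise_weight_pos[OF assms]
  by (intro sum_le_suminf summable_noise_weight assms) (auto intro: less_imp_le)

lemma gamma1_pos:
  assumes "L > 0"
  shows "gamma1 L > 0"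
  using sum_noise_weight_le_gamma1[OF assms, of 1] noise_weight_pos[OF assms, of 0] by simp

definition growth :: "real \<Rightarrow> real \<Rightarrow> nat \<Rightarrow> real" where
  "growth L \<sigma> n = (\<Prod>j<n. 1 + \<sigma>\<^sup>2 * noise_weight L j)"

lemma growth_Suc: "growth L \<sigma> (Suc n) = growth L \<sigma> n * (1 + \<sigma>\<^sup>2 * noise_weight L n)"
  by (simp add: growth_def)

lemma growth_ge_1:
  assumes "L > 0"
  shows "growth L \<sigma> n \<ge> 1"
  unfolding growth_def using noise_weight_pos[OF assms]
  by (intro prod_ge_1) (simp add: less_imp_le)

lemma growth_le_gamma2:
  assumes "L > 0"
  shows "growth L \<sigma> n \<le> gamma2 L \<sigma>"
proof -
  define a where "a j = \<sigma>\<^sup>2 * noise_weight L j" for j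
  have a: "a j \<ge> 0" for j
    using noise_weight_pos[OF assms, of j] by (simp add: a_def)
  have "summable (\<lambda>j. \<bar>a j\<bar>)"
    using summable_mult[OF summable_noise_weight[OF assms]] a by (simp add: a_def)
  moreover have "a j \<noteq> - 1" for j
    using a[of j] by linarith
  ultimately have "convergent_prod (\<lambda>j. 1 + a j)"
    by (rule summable_imp_convergent_prod_real)
  then have "(\<Prod>j<n. 1 + a j) \<le> prodinf (\<lambda>j. 1 + a j)"
    using a by (intro prod_le_prodinf convergent_prod_has_prod) (auto simp: add_nonneg_nonneg)
  then show ?thesis
    by (simp add: growth_def gamma2_def a_def noise_weight_def mult.commute)
qed

text \<open>A discrete Gronwall estimate: each factor adds \<open>\<sigma>\<^sup>2 h\<^sub>n\<close> times the current partial product, which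
  is at most \<open>\<gamma>\<^sub>2\<close>.\<close>

lemma growth_le_gronwall:
  assumes "L > 0"
  shows "growth L \<sigma> n \<le> 1 + \<sigma>\<^sup>2 * gamma1 L * gamma2 L \<sigma>"
proof -
  have "growth L \<sigma> n \<le> 1 + \<sigma>\<^sup>2 * (\<Sum>j<n. noise_weight L j) * gamma2 L \<sigma>"
  proof (induction n)
    case 0
    show ?case by (simp add: growth_def)
  next
    case (Suc n)
    have "growth L \<sigma> n * (\<sigma>\<^sup>2 * noise_weight L n) \<le> gamma2 L \<sigma> * (\<sigma>\<^sup>2 * noise_weight L n)"
      using noise_weight_pos[OF assms, of n]
      by (intro mult_right_mono growth_le_gamma2 assms) simp
    with Suc show ?case
      by (simp add: growth_Suc algebra_simps)
  qed
  also have "\<dots> \<le> 1 + \<sigma>\<^sup>2 * gamma1 L * gamma2 L \<sigma>"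
    using growth_le_gamma2[OF assms, of \<sigma> 0]
    by (intro add_left_mono mult_right_mono mult_left_mono sum_noise_weight_le_gamma1 assms)
      (auto simp: growth_def)
  finally show ?thesis .
qed

section \<open>Descent of the Lyapunov function\<close>

definition lyapunov ::
  "real \<Rightarrow> ('a::real_normed_vector \<Rightarrow> real) \<Rightarrow> 'a \<Rightarrow> nat \<Rightarrow> 'a \<Rightarrow> 'a \<Rightarrow> real" where
  "lyapunov L f xstar k u v =
     (norm (v + (real k + 1) *\<^sub>R (v - u) - xstar))\<^sup>2
       + 4 * sqrt ((real k + 1) * stepsize L k) * (f u - f xstar)"

lemma lyapunov_0: "lyapunov L f xstar 0 u v = lyapunov_init L f xstar u v"
  by (simp add: lyapunov_def lyapunov_init_def)

lemma norm_le_lyapunov: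
  assumes "f xstar \<le> f u" "L > 0"
  shows "(norm (v + (real k + 1) *\<^sub>R (v - u) - xstar))\<^sup>2 \<le> lyapunov L f xstar k u v"
  using assms stepsize_pos[OF assms(2), of k] by (simp add: lyapunov_def)

lemma suboptimality_le_lyapunov:
  assumes "L > 0"
  shows "f u - f xstar \<le> L * lyapunov L f xstar k u v * ln (real k + 2) / sqrt (real k + 1)"
proof -
  define l s where "l = ln (real k + 2)" and "s = sqrt (real k + 1)"
  have pos: "l > 0" "s > 0"
    by (simp_all add: l_def s_def)
  have "4 * sqrt ((real k + 1) * stepsize L k) = s / (L * l)"
    by (simp add: real_sqrt_mult sqrt_stepsize[OF assms] l_def s_def)
  then have "s / (L * l) * (f u - f xstar) \<le> lyapunov L f xstar k u v"
    by (simp add: lyapunov_def)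
  then show ?thesis
    using pos assms unfolding l_def[symmetric] s_def[symmetric] by (simp add: field_simps)
qed

text \<open>This is where the momentum coefficient matters: it makes the vector inside the norm move by
  exactly \<open>-2 \<surd>(\<eta>\<^sub>k / k) G\<close>. The factor \<open>\<surd>((k + 1) \<eta>\<^sub>k)\<close> in front of the suboptimality
  is small enough for the inner product with the gradient to pay for it, and \<open>\<surd>\<eta>\<^sub>k \<le> 1 / (4L)\<close> lets the gain \<open>\<parallel>\<nabla>f\<parallel>\<^sup>2 / (2L)\<close> absorb
  the gradient part of \<open>\<parallel>G\<parallel>\<^sup>2\<close>.\<close>

lemma lyapunov_step:
  fixes f :: "'a::euclidean_space \<Rightarrow> real"
  assumes "L > 0" "convex_on UNIV f" "smooth_fun L f" and min: "\<And>y. f xstar \<le> f y"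
    and k: "k = Suc n"
    and x2: "x2 = x1 + (real k / (real k + 2)) *\<^sub>R (x1 - x0)
        - (2 * sqrt (stepsize L k) / ((real k + 2) * sqrt (real k))) *\<^sub>R G"
  shows "lyapunov L f xstar k x1 x2 \<le> lyapunov L f xstar n x0 x1
    + noise_weight L n * (norm (G - grad f x1))\<^sup>2
    - sqrt (noise_weight L n) * ((G - grad f x1) \<bullet> (x1 + real k *\<^sub>R (x1 - x0) - xstar))"
proof -
  define \<eta> where "\<eta> = stepsize L k"
  define c where "c = sqrt (\<eta> / real k)"
  define v where "v = grad f x1"
  define e where "e = G - v"
  define w where "w = x1 + real k *\<^sub>R (x1 - x0) - xstar"
  define a0 a1 where "a0 = f x0 - f xstar" and "a1 = f x1 - f xstar"
  have k1: "k \<ge> 1"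
    using k by simp
  have \<eta>: "\<eta> > 0"
    unfolding \<eta>_def by (intro stepsize_pos assms)
  have c: "c > 0"
    using \<eta> k1 by (simp add: c_def)
  have c2: "noise_weight L n = 16 * c\<^sup>2"
    using \<eta> k1 k by (simp add: noise_weight_def c_def \<eta>_def)
  have sqrt_nw: "sqrt (noise_weight L n) = 4 * c"
    using c by (simp add: c2 real_sqrt_mult)
  have a: "a0 \<ge> 0" "a1 \<ge> 0"
    using min by (simp_all add: a0_def a1_def)
  have cL: "c \<le> 1 / (4 * L)"
  proof -
    have "c \<le> sqrt \<eta>"
      unfolding c_def using \<eta> k1 by (simp add: field_simps)
    also have "\<dots> = 1 / (4 * L * ln (real k + 2))"
      unfolding \<eta>_def by (rule sqrt_stepsize[OF assms(1)])
    also have "\<dots> \<le> 1 / (4 * L)"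
      using one_le_ln_add_2[OF k1] assms(1) by (intro divide_left_mono) auto
    finally show ?thesis .
  qed

  have shift: "x2 + (real k + 1) *\<^sub>R (x2 - x1) - xstar = w - (2 * c) *\<^sub>R G"
  proof -
    have "x2 - x1 = (real k / (real k + 2)) *\<^sub>R (x1 - x0) - (2 * c / (real k + 2)) *\<^sub>R G"
      by (simp add: x2 c_def \<eta>_def real_sqrt_divide field_simps)
    then have "(real k + 2) *\<^sub>R (x2 - x1) = real k *\<^sub>R (x1 - x0) - (2 * c) *\<^sub>R G"
      by (simp add: scaleR_diff_right add_eq_0_iff)
    moreover have "x2 + (real k + 1) *\<^sub>R (x2 - x1) - xstar
        = (real k + 2) *\<^sub>R (x2 - x1) + (x1 - xstar)"
      by (simp add: algebra_simps scaleR_2)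
    ultimately show ?thesis
      by (simp add: w_def)
  qed
  (* Splitting G into gradient and noise isolates the martingale term e \<bullet> w. *)
  have expand: "(norm (w - (2 * c) *\<^sub>R G))\<^sup>2
      = (norm w)\<^sup>2 - 4 * c * (w \<bullet> v) - 4 * c * (e \<bullet> w) + 4 * c\<^sup>2 * (norm G)\<^sup>2"
  proof -
    have "(norm (w - (2 * c) *\<^sub>R G))\<^sup>2 = (norm w)\<^sup>2 - 4 * c * (w \<bullet> G) + 4 * c\<^sup>2 * (norm G)\<^sup>2"
      unfolding power2_norm_eq_inner
      by (simp add: inner_diff_left inner_diff_right inner_commute algebra_simps power2_eq_square)
    moreover have "w \<bullet> G = w \<bullet> v + e \<bullet> w"
      by (simp add: e_def inner_diff_left inner_diff_right inner_commute)
    ultimately show ?thesis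
      by (simp add: algebra_simps)
  qed
  have G: "(norm G)\<^sup>2 \<le> 2 * (norm v)\<^sup>2 + 2 * (norm e)\<^sup>2"
  proof -
    have "0 \<le> (norm (v - e))\<^sup>2"
      by simp
    moreover have "G = v + e"
      by (simp add: e_def)
    ultimately show ?thesis
      by (simp add: power2_norm_eq_inner inner_diff_left inner_diff_right inner_add_left
          inner_add_right inner_commute)
  qed
  have descent: "(real k + 1) * a1 - real k * a0 + (norm v)\<^sup>2 / (2 * L) \<le> w \<bullet> v"
  proof -
    have "a1 + (norm v)\<^sup>2 / (2 * L) \<le> (x1 - xstar) \<bullet> v"
      unfolding a1_def v_def by (intro inner_grad_ge_suboptimality assms)
    moreover have "a1 - a0 \<le> (x1 - x0) \<bullet> v"
      using convex_gradient_lower_bound[OF assms(2) smooth_fun_gderiv[OF assms(3)], of x1 x0]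
      by (simp add: a0_def a1_def v_def inner_diff_left)
    then have "real k * (a1 - a0) \<le> real k * ((x1 - x0) \<bullet> v)"
      by (rule mult_left_mono) simp
    ultimately show ?thesis
      by (simp add: w_def inner_add_left inner_diff_left algebra_simps)
  qed
  have grad_absorbed: "8 * c\<^sup>2 * (norm v)\<^sup>2 \<le> 4 * c * ((norm v)\<^sup>2 / (2 * L))"
  proof -
    have "c * c * (8 * (norm v)\<^sup>2) \<le> c * (1 / (4 * L)) * (8 * (norm v)\<^sup>2)"
      using c cL by (intro mult_right_mono mult_left_mono) auto
    then show ?thesis
      by (simp add: power2_eq_square field_simps)
  qed
  (* The potential terms do not grow: the coefficient of the new suboptimality is bounded by what
     the inner product provides, and that of the old one by its coefficient in the previous value. *)
  have coeff1: "sqrt ((real k + 1) * \<eta>) \<le> c * (real k + 1)"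
  proof -
    have "(real k + 1) * \<eta> \<le> c\<^sup>2 * (real k + 1)\<^sup>2"
      using \<eta> k1 by (simp add: c_def power2_eq_square field_simps)
    then show ?thesis
      using c by (intro real_le_lsqrt) (auto simp: power_mult_distrib)
  qed
  have coeff0: "c * real k \<le> sqrt (real k * stepsize L n)"
  proof -
    have "c\<^sup>2 * (real k)\<^sup>2 = real k * \<eta>"
      using \<eta> k1 by (simp add: c_def power2_eq_square)
    also have "\<dots> \<le> real k * stepsize L n"
      using stepsize_antimono[OF assms(1), of n] by (simp add: \<eta>_def k)
    finally show ?thesis
      by (intro real_le_rsqrt) (simp add: power_mult_distrib)
  qed
  have "lyapunov L f xstar k x1 x2
      = (norm (w - (2 * c) *\<^sub>R G))\<^sup>2 + 4 * (sqrt ((real k + 1) * \<eta>) * a1)"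
    by (simp add: lyapunov_def shift a1_def \<eta>_def)
  also have "\<dots> \<le> (norm w)\<^sup>2 - 4 * c * ((real k + 1) * a1 - real k * a0 + (norm v)\<^sup>2 / (2 * L))
      - 4 * c * (e \<bullet> w) + 4 * c\<^sup>2 * (2 * (norm v)\<^sup>2 + 2 * (norm e)\<^sup>2) + 4 * (c * (real k + 1) * a1)"
    unfolding expand using c a descent G
    by (intro add_mono diff_mono mult_left_mono mult_right_mono coeff1) auto
  also have "\<dots> = (norm w)\<^sup>2 + 4 * (c * real k * a0) + 8 * c\<^sup>2 * (norm e)\<^sup>2 - 4 * c * (e \<bullet> w)
      + (8 * c\<^sup>2 * (norm v)\<^sup>2 - 4 * c * ((norm v)\<^sup>2 / (2 * L)))"
    by (simp add: algebra_simps)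
  also have "\<dots> \<le> (norm w)\<^sup>2 + 4 * (sqrt (real k * stepsize L n) * a0)
      + 16 * c\<^sup>2 * (norm e)\<^sup>2 - 4 * c * (e \<bullet> w) + 0"
    using a c grad_absorbed by (intro add_mono diff_mono mult_left_mono mult_right_mono coeff0) auto
  also have "(norm w)\<^sup>2 + 4 * (sqrt (real k * stepsize L n) * a0) = lyapunov L f xstar n x0 x1"
    by (simp add: lyapunov_def w_def a0_def k add.commute)
  finally show ?thesis
    unfolding sqrt_nw by (simp add: c2 e_def v_def w_def)
qed

section \<open>Conditional exponential moments of subgaussian noise\<close>

text \<open>Unlike \<open>exp t \<le> 1 + t + t\<^sup>2\<close>, this bound holds for all real \<open>t\<close>, and its linear part vanishes under
  the expectation of a centred variable.\<close>

lemma exp_le_add_exp_square: "exp t \<le> t + exp (t\<^sup>2)" for t :: real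
proof -
  have square: "1 + t\<^sup>2 \<le> exp (t\<^sup>2)"
    by (rule exp_ge_add_one_self)
  consider "t \<le> 0" | "0 \<le> t" "t \<le> 1" | "1 \<le> t"
    by linarith
  then show ?thesis
  proof cases
    case 1
    have "(1 + t + t\<^sup>2) * (1 - t) = 1 + (- t) ^ 3"
      by (simp add: algebra_simps power2_eq_square power3_eq_cube)
    then have "1 \<le> (1 + t + t\<^sup>2) * (1 - t)"
      using 1 by simp
    also have "\<dots> \<le> (1 + t + t\<^sup>2) * exp (- t)"
    proof (rule mult_left_mono)
      show "1 - t \<le> exp (- t)"
        using exp_ge_add_one_self[of "- t"] by simp
      have "1 + t + t\<^sup>2 = (t + 1 / 2)\<^sup>2 + 3 / 4"
        by (simp add: power2_eq_square algebra_simps)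
      then show "0 \<le> 1 + t + t\<^sup>2"
        by simp
    qed
    finally have "exp t \<le> 1 + t + t\<^sup>2"
      by (simp add: exp_minus divide_simps)
    with square show ?thesis
      by linarith
  next
    case 2
    then have "exp t \<le> 1 + t + t\<^sup>2"
      by (rule exp_bound)
    with square show ?thesis
      by linarith
  next
    case 3
    then have "t \<le> t\<^sup>2"
      by (simp add: power2_eq_square)
    then have "exp t \<le> exp (t\<^sup>2)"
      by simp
    with 3 show ?thesis
      by linarith
  qed
qed

lemma exp_scaled_le:
  fixes s r :: real
  assumes "0 \<le> s" "s \<le> 1"
  shows "exp (s * r) \<le> 1 - s + s * exp r"
  using convex_onD[OF exp_convex, of s 0 r] assms by simp

text \<open>The next two lemmas bound \<open>exp (\<langle>e, v\<rangle> - \<sigma>\<^sup>2 \<parallel>v\<parallel>\<^sup>2)\<close> by a term that is linear in \<open>e\<close> plus a convex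
  combination of \<open>1\<close> and \<open>exp (\<parallel>e\<parallel>\<^sup>2 / \<sigma>\<^sup>2 - 1)\<close>, whose coefficients depend only on \<open>v\<close>. Conditional
  expectations of such an expression can be computed by linearity. For small \<open>v\<close> the centring
  of \<open>e\<close> is essential; for large \<open>v\<close> the arithmetic-geometric mean inequality suffices, without
  any linear term.\<close>

lemma exp_inner_le_small:
  fixes e v :: "'a::real_inner"
  assumes "\<sigma> > 0" and s: "s = \<sigma>\<^sup>2 * (norm v)\<^sup>2" "s \<le> 1"
  shows "exp (e \<bullet> v - s) \<le> e \<bullet> (exp (- s) *\<^sub>R v) + (1 - s) + s * exp ((norm e)\<^sup>2 / \<sigma>\<^sup>2 - 1)"
proof -
  define q where "q = (norm e)\<^sup>2 / \<sigma>\<^sup>2"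
  have "(e \<bullet> v)\<^sup>2 \<le> (norm e * norm v)\<^sup>2"
    using Cauchy_Schwarz_ineq2[of e v] by (simp add: abs_le_square_iff[symmetric])
  also have "\<dots> = s * q"
    using assms(1) by (simp add: s q_def power_mult_distrib)
  finally have "exp (e \<bullet> v) \<le> e \<bullet> v + exp (s * q)"
    using exp_le_add_exp_square[of "e \<bullet> v"] by (smt (verit) exp_le_cancel_iff)
  then have "exp (- s) * exp (e \<bullet> v) \<le> exp (- s) * (e \<bullet> v + exp (s * q))"
    by (rule mult_left_mono) simp
  moreover have "exp (- s) * exp (e \<bullet> v) = exp (e \<bullet> v - s)"
    by (simp add: exp_add[symmetric])
  moreover have "exp (- s) * exp (s * q) = exp (s * (q - 1))"
    by (simp add: exp_add[symmetric] algebra_simps)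
  moreover have "exp (s * (q - 1)) \<le> 1 - s + s * exp (q - 1)"
    using s by (intro exp_scaled_le) auto
  ultimately show ?thesis
    by (simp add: q_def distrib_left)
qed

lemma exp_inner_le_large:
  fixes e v :: "'a::real_inner"
  assumes "\<sigma> > 0" and s: "s = \<sigma>\<^sup>2 * (norm v)\<^sup>2" "s \<ge> 1"
  shows "exp (e \<bullet> v - s) \<le> 1 / 2 + 1 / 2 * exp ((norm e)\<^sup>2 / \<sigma>\<^sup>2 - 1)"
proof -
  define q where "q = (norm e)\<^sup>2 / \<sigma>\<^sup>2"
  have "0 \<le> (norm e / \<sigma> - \<sigma> * norm v)\<^sup>2"
    by simp
  also have "\<dots> = q + s - 2 * (norm e * norm v)"
    using assms(1) by (simp add: q_def s power2_diff power_divide power_mult_distrib)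
  finally have "e \<bullet> v - s \<le> 1 / 2 * (q - 1)"
    using norm_cauchy_schwarz[of e v] s(2) by simp
  then have "exp (e \<bullet> v - s) \<le> exp (1 / 2 * (q - 1))"
    by simp
  also have "\<dots> \<le> 1 - 1 / 2 + 1 / 2 * exp (q - 1)"
    by (intro exp_scaled_le) auto
  finally show ?thesis
    by (simp add: q_def)
qed

lemma (in sigma_finite_subalgebra) nn_cond_exp_eq_real_cond_exp:
  assumes B: "integrable M B" and nonneg: "\<And>\<omega>. 0 \<le> B \<omega>"
  shows "AE \<omega> in M. nn_cond_exp M F (\<lambda>\<omega>. ennreal (B \<omega>)) \<omega> = ennreal (real_cond_exp M F B \<omega>)"
proof -
  have [measurable]: "B \<in> borel_measurable M"
    using B by simp
  have "(\<integral>\<^sup>+ \<omega>. nn_cond_exp M F (\<lambda>\<omega>. ennreal (B \<omega>)) \<omega> \<partial>M) = (\<integral>\<^sup>+ \<omega>. ennreal (B \<omega>) \<partial>M)"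
    using nn_cond_exp_intg[of "\<lambda>_. 1" "\<lambda>\<omega>. ennreal (B \<omega>)"] by simp
  also have "\<dots> \<noteq> \<infinity>"
    using B nonneg by (simp add: nn_integral_eq_integral)
  finally have finite: "AE \<omega> in M. nn_cond_exp M F (\<lambda>\<omega>. ennreal (B \<omega>)) \<omega> \<noteq> \<infinity>"
    by (intro nn_integral_noteq_infinite) auto
  have "(\<lambda>\<omega>. ennreal (- B \<omega>)) = (\<lambda>_. 0)"
    using nonneg by (simp add: ennreal_neg)
  then have "AE \<omega> in M. 0 = nn_cond_exp M F (\<lambda>\<omega>. ennreal (- B \<omega>)) \<omega>"
    using nn_cond_exp_F_meas[of "\<lambda>_. 0"] by simp
  with finite show ?thesis
    by eventually_elim (simp add: real_cond_exp_def less_top)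
qed

lemma integrable_inner_bounded:
  fixes e u :: "'a \<Rightarrow> 'b::euclidean_space"
  assumes e: "integrable M e" and [measurable]: "u \<in> borel_measurable M"
    and bound: "\<And>\<omega>. norm (u \<omega>) \<le> K"
  shows "integrable M (\<lambda>\<omega>. e \<omega> \<bullet> u \<omega>)"
proof (rule Bochner_Integration.integrable_bound)
  show "integrable M (\<lambda>\<omega>. K * norm (e \<omega>))"
    using e by auto
  have [measurable]: "e \<in> borel_measurable M"
    using e by simp
  show "(\<lambda>\<omega>. e \<omega> \<bullet> u \<omega>) \<in> borel_measurable M"
    by measurable
  have "\<bar>e \<omega> \<bullet> u \<omega>\<bar> \<le> \<bar>K * norm (e \<omega>)\<bar>" for \<omega>
  proof -
    have "\<bar>e \<omega> \<bullet> u \<omega>\<bar> \<le> norm (e \<omega>) * norm (u \<omega>)"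
      by (rule Cauchy_Schwarz_ineq2)
    also have "\<dots> \<le> norm (e \<omega>) * K"
      by (intro mult_left_mono bound) simp
    finally show ?thesis
      by (simp add: mult.commute)
  qed
  then show "AE \<omega> in M. norm (e \<omega> \<bullet> u \<omega>) \<le> norm (K * norm (e \<omega>))"
    by simp
qed

lemma (in sigma_finite_subalgebra) real_cond_exp_inner_bounded:
  fixes e u :: "'a \<Rightarrow> 'b::euclidean_space"
  assumes e: "integrable M e" and u: "u \<in> borel_measurable F"
    and bound: "\<And>\<omega>. norm (u \<omega>) \<le> K"
    and centred: "\<And>b. b \<in> Basis \<Longrightarrow> AE \<omega> in M. real_cond_exp M F (\<lambda>\<omega>. e \<omega> \<bullet> b) \<omega> = 0"
  shows "AE \<omega> in M. real_cond_exp M F (\<lambda>\<omega>. e \<omega> \<bullet> u \<omega>) \<omega> = 0"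
proof -
  have [measurable]: "e \<in> borel_measurable M"
    using e by simp
  note [measurable] = u measurable_from_subalg[OF subalg u]
  have int: "integrable M (\<lambda>\<omega>. (u \<omega> \<bullet> b) * (e \<omega> \<bullet> b))" for b
  proof -
    have "norm ((u \<omega> \<bullet> b) *\<^sub>R b) \<le> K * norm b * norm b" for \<omega>
    proof -
      have "\<bar>u \<omega> \<bullet> b\<bar> \<le> norm (u \<omega>) * norm b"
        by (rule Cauchy_Schwarz_ineq2)
      also have "\<dots> \<le> K * norm b"
        by (intro mult_right_mono bound) simp
      finally show ?thesis
        by (simp add: mult_right_mono)
    qed
    from integrable_inner_bounded[OF e _ this] show ?thesis
      by simp
  qed
  have "AE \<omega> in M. real_cond_exp M F (\<lambda>\<omega>. \<Sum>b\<in>Basis. (u \<omega> \<bullet> b) * (e \<omega> \<bullet> b)) \<omega>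
      = (\<Sum>b\<in>Basis. real_cond_exp M F (\<lambda>\<omega>. (u \<omega> \<bullet> b) * (e \<omega> \<bullet> b)) \<omega>)"
    by (rule real_cond_exp_sum[OF int])
  moreover have "AE \<omega> in M. \<forall>b\<in>Basis. real_cond_exp M F (\<lambda>\<omega>. (u \<omega> \<bullet> b) * (e \<omega> \<bullet> b)) \<omega> = 0"
  proof (rule AE_finite_allI[OF finite_Basis])
    fix b :: 'b
    assume "b \<in> Basis"
    have "AE \<omega> in M. real_cond_exp M F (\<lambda>\<omega>. (u \<omega> \<bullet> b) * (e \<omega> \<bullet> b)) \<omega>
        = (u \<omega> \<bullet> b) * real_cond_exp M F (\<lambda>\<omega>. e \<omega> \<bullet> b) \<omega>"
      by (rule real_cond_exp_mult) (use int in auto)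
    with centred[OF \<open>b \<in> Basis\<close>]
    show "AE \<omega> in M. real_cond_exp M F (\<lambda>\<omega>. (u \<omega> \<bullet> b) * (e \<omega> \<bullet> b)) \<omega> = 0"
      by eventually_elim simp
  qed
  moreover have "(\<lambda>\<omega>. e \<omega> \<bullet> u \<omega>) = (\<lambda>\<omega>. \<Sum>b\<in>Basis. (u \<omega> \<bullet> b) * (e \<omega> \<bullet> b))"
    by (subst euclidean_inner) (simp add: mult.commute)
  ultimately show ?thesis
    by auto
qed

lemma (in finite_measure_subalgebra) integrable_of_nn_cond_exp_le:
  assumes [measurable]: "Y \<in> borel_measurable M" and nonneg: "\<And>\<omega>. 0 \<le> Y \<omega>"
    and bound: "AE \<omega> in M. nn_cond_exp M F (\<lambda>\<omega>. ennreal (Y \<omega>)) \<omega> \<le> ennreal c"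
  shows "integrable M Y"
proof (rule integrableI_nonneg)
  have "(\<integral>\<^sup>+ \<omega>. ennreal (Y \<omega>) \<partial>M) = (\<integral>\<^sup>+ \<omega>. nn_cond_exp M F (\<lambda>\<omega>. ennreal (Y \<omega>)) \<omega> \<partial>M)"
    using nn_cond_exp_intg[of "\<lambda>_. 1" "\<lambda>\<omega>. ennreal (Y \<omega>)"] by simp
  also have "\<dots> \<le> (\<integral>\<^sup>+ \<omega>. ennreal c \<partial>M)"
    by (rule nn_integral_mono_AE[OF bound])
  also have "\<dots> < \<infinity>"
    by (simp add: ennreal_mult_eq_top_iff less_top[symmetric])
  finally show "(\<integral>\<^sup>+ \<omega>. ennreal (Y \<omega>) \<partial>M) < \<infinity>" .
qed (use nonneg in auto)

lemma integrable_of_exp_square: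
  fixes e :: "'a \<Rightarrow> 'b::euclidean_space"
  assumes [measurable]: "e \<in> borel_measurable M" and "\<sigma> > 0"
    and Y: "integrable M (\<lambda>\<omega>. exp ((norm (e \<omega>))\<^sup>2 / \<sigma>\<^sup>2))"
  shows "integrable M e"
proof (rule Bochner_Integration.integrable_bound)
  show "integrable M (\<lambda>\<omega>. \<sigma> * exp ((norm (e \<omega>))\<^sup>2 / \<sigma>\<^sup>2))"
    using Y by simp
  have "norm (e \<omega>) \<le> \<sigma> * exp ((norm (e \<omega>))\<^sup>2 / \<sigma>\<^sup>2)" for \<omega>
  proof -
    define r where "r = norm (e \<omega>) / \<sigma>"
    have "0 \<le> (r - 1 / 2)\<^sup>2"
      by simp
    then have "r \<le> 1 + r\<^sup>2"
      by (simp add: power2_eq_square algebra_simps)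
    also have "\<dots> \<le> exp (r\<^sup>2)"
      by (rule exp_ge_add_one_self)
    finally show ?thesis
      using \<open>\<sigma> > 0\<close> by (simp add: r_def power_divide field_simps)
  qed
  then show "AE \<omega> in M. norm (e \<omega>) \<le> norm (\<sigma> * exp ((norm (e \<omega>))\<^sup>2 / \<sigma>\<^sup>2))"
    using \<open>\<sigma> > 0\<close> by simp
qed simp

text \<open>The common end of both exponential moment estimates below: \<open>D\<close> is a centred part and \<open>s\<close> the
  predictable coefficient of the convex combination of \<open>1\<close> and \<open>Y\<close>.\<close>

lemma (in finite_measure_subalgebra) real_cond_exp_convex_combination_le:
  assumes Y: "integrable M Y" "\<And>\<omega>. 0 \<le> Y \<omega>"
    and Y_bound: "AE \<omega> in M. nn_cond_exp M F (\<lambda>\<omega>. ennreal (Y \<omega>)) \<omega> \<le> 1"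
    and D: "integrable M D" "AE \<omega> in M. real_cond_exp M F D \<omega> = 0"
    and s: "s \<in> borel_measurable F" "\<And>\<omega>. 0 \<le> s \<omega>" "\<And>\<omega>. s \<omega> \<le> 1"
    and X: "X \<in> borel_measurable M" "\<And>\<omega>. 0 \<le> X \<omega>"
      "\<And>\<omega>. X \<omega> \<le> D \<omega> + (1 - s \<omega>) + s \<omega> * Y \<omega>"
  shows "AE \<omega> in M. nn_cond_exp M F (\<lambda>\<omega>. ennreal (X \<omega>)) \<omega> \<le> 1"
proof -
  note [measurable] = s(1) measurable_from_subalg[OF subalg s(1)] X(1)
  have [measurable]: "Y \<in> borel_measurable M" "D \<in> borel_measurable M"
    using Y D by auto
  define B where "B \<omega> = D \<omega> + ((1 - s \<omega>) + s \<omega> * Y \<omega>)" for \<omega>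
  have int_s: "integrable M (\<lambda>\<omega>. 1 - s \<omega>)"
    by (rule integrable_const_bound[of _ 1]) (use s in \<open>auto simp: abs_le_iff\<close>)
  have int_sY: "integrable M (\<lambda>\<omega>. s \<omega> * Y \<omega>)"
    by (rule Bochner_Integration.integrable_bound[OF Y(1)])
      (use s Y in \<open>auto simp: abs_mult intro!: mult_left_le_one_le\<close>)
  have int_B: "integrable M B"
    unfolding B_def using D int_s int_sY by auto
  have B_nonneg: "0 \<le> B \<omega>" for \<omega>
    using X(2,3)[of \<omega>] by (simp add: B_def)
  have "AE \<omega> in M. real_cond_exp M F B \<omega>
      = real_cond_exp M F D \<omega> + real_cond_exp M F (\<lambda>\<omega>. (1 - s \<omega>) + s \<omega> * Y \<omega>) \<omega>"
    unfolding B_def by (rule real_cond_exp_add) (use D int_s int_sY in auto)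
  moreover have "AE \<omega> in M. real_cond_exp M F (\<lambda>\<omega>. (1 - s \<omega>) + s \<omega> * Y \<omega>) \<omega>
      = real_cond_exp M F (\<lambda>\<omega>. 1 - s \<omega>) \<omega> + real_cond_exp M F (\<lambda>\<omega>. s \<omega> * Y \<omega>) \<omega>"
    by (rule real_cond_exp_add[OF int_s int_sY])
  moreover have "AE \<omega> in M. real_cond_exp M F (\<lambda>\<omega>. 1 - s \<omega>) \<omega> = 1 - s \<omega>"
    by (rule real_cond_exp_F_meas[OF int_s]) measurable
  moreover have "AE \<omega> in M. real_cond_exp M F (\<lambda>\<omega>. s \<omega> * Y \<omega>) \<omega> = s \<omega> * real_cond_exp M F Y \<omega>"
    by (rule real_cond_exp_mult) (use int_sY in auto)
  moreover have "AE \<omega> in M. nn_cond_exp M F (\<lambda>\<omega>. ennreal (Y \<omega>)) \<omega> = ennreal (real_cond_exp M F Y \<omega>)"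
    by (rule nn_cond_exp_eq_real_cond_exp[OF Y])
  moreover have "AE \<omega> in M. nn_cond_exp M F (\<lambda>\<omega>. ennreal (B \<omega>)) \<omega> = ennreal (real_cond_exp M F B \<omega>)"
    by (rule nn_cond_exp_eq_real_cond_exp[OF int_B B_nonneg])
  moreover have "AE \<omega> in M. nn_cond_exp M F (\<lambda>\<omega>. ennreal (X \<omega>)) \<omega>
      \<le> nn_cond_exp M F (\<lambda>\<omega>. ennreal (B \<omega>)) \<omega>"
    by (rule nn_cond_exp_mono) (use X(3) in \<open>auto intro!: ennreal_leI simp: B_def add.assoc\<close>)
  ultimately show ?thesis
    using D(2) Y_bound
  proof eventually_elim
    case (elim \<omega>)
    then have "real_cond_exp M F Y \<omega> \<le> 1"
      by simp
    then have "s \<omega> * real_cond_exp M F Y \<omega> \<le> s \<omega> * 1"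
      by (intro mult_left_mono s)
    with elim have "real_cond_exp M F B \<omega> \<le> 1"
      by simp
    with elim show ?case
      by (metis ennreal_1 ennreal_leI order_trans)
  qed
qed

lemma (in finite_measure_subalgebra) nn_cond_exp_divide_le_1:
  assumes [measurable]: "Y \<in> borel_measurable M" and "c > 0" 
    and bound: "AE \<omega> in M. nn_cond_exp M F (\<lambda>\<omega>. ennreal (Y \<omega>)) \<omega> \<le> ennreal c"
  shows "AE \<omega> in M. nn_cond_exp M F (\<lambda>\<omega>. ennreal (Y \<omega> / c)) \<omega> \<le> 1"
proof -
  have "AE \<omega> in M. ennreal (1 / c) * nn_cond_exp M F (\<lambda>\<omega>. ennreal (Y \<omega>)) \<omega>
      = nn_cond_exp M F (\<lambda>\<omega>. ennreal (1 / c) * ennreal (Y \<omega>)) \<omega>"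
    by (rule nn_cond_exp_prod) auto
  moreover have "(\<lambda>\<omega>. ennreal (1 / c) * ennreal (Y \<omega>)) = (\<lambda>\<omega>. ennreal (Y \<omega> / c))"
    using \<open>c > 0\<close> by (simp add: ennreal_mult'[symmetric])
  ultimately have "AE \<omega> in M. ennreal (1 / c) * nn_cond_exp M F (\<lambda>\<omega>. ennreal (Y \<omega>)) \<omega>
      = nn_cond_exp M F (\<lambda>\<omega>. ennreal (Y \<omega> / c)) \<omega>"
    by simp
  with bound show ?thesis
  proof eventually_elim
    case (elim \<omega>)
    have "ennreal (1 / c) * nn_cond_exp M F (\<lambda>\<omega>. ennreal (Y \<omega>)) \<omega> \<le> ennreal (1 / c) * ennreal c"
      by (intro mult_left_mono elim) simp
    also have "\<dots> = 1"
      using \<open>c > 0\<close> by (simp add: ennreal_mult'[symmetric])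
    finally show ?case
      using elim by simp
  qed
qed

context finite_measure_subalgebra
begin

context
  fixes e :: "'a \<Rightarrow> 'b::euclidean_space" and \<sigma> :: real
  assumes e [measurable]: "e \<in> borel_measurable M" and \<sigma>: "\<sigma> > 0"
    and subgaussian: "AE \<omega> in M. nn_cond_exp M F (\<lambda>\<omega>. ennreal (exp ((norm (e \<omega>))\<^sup>2 / \<sigma>\<^sup>2))) \<omega>
      \<le> ennreal (exp 1)"
begin

lemma subgaussian_exp_integrable: "integrable M (\<lambda>\<omega>. exp ((norm (e \<omega>))\<^sup>2 / \<sigma>\<^sup>2))"
  by (rule integrable_of_nn_cond_exp_le[OF _ _ subgaussian]) auto

lemma subgaussian_integrable: "integrable M e"
  by (rule integrable_of_exp_square[OF e \<sigma> subgaussian_exp_integrable])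

lemma subgaussian_normalized:
  shows "integrable M (\<lambda>\<omega>. exp ((norm (e \<omega>))\<^sup>2 / \<sigma>\<^sup>2 - 1))"
    and "AE \<omega> in M. nn_cond_exp M F (\<lambda>\<omega>. ennreal (exp ((norm (e \<omega>))\<^sup>2 / \<sigma>\<^sup>2 - 1))) \<omega> \<le> 1"
  using nn_cond_exp_divide_le_1[OF _ _ subgaussian] subgaussian_exp_integrable
  by (simp_all add: exp_diff)

lemma nn_cond_exp_exp_square_le_1:
  assumes "0 \<le> p" "p \<le> 1"
  shows "AE \<omega> in M. nn_cond_exp M F (\<lambda>\<omega>. ennreal (exp (p * ((norm (e \<omega>))\<^sup>2 / \<sigma>\<^sup>2 - 1)))) \<omega> \<le> 1"
proof (rule real_cond_exp_convex_combination_le[OF subgaussian_normalized(1) _ subgaussian_normalized(2),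
      where D = "\<lambda>_. 0" and s = "\<lambda>_. p"])
  show "AE \<omega> in M. real_cond_exp M F (\<lambda>_. 0) \<omega> = 0"
    by (rule real_cond_exp_F_meas) auto
  show "exp (p * ((norm (e \<omega>))\<^sup>2 / \<sigma>\<^sup>2 - 1)) \<le> 0 + (1 - p) + p * exp ((norm (e \<omega>))\<^sup>2 / \<sigma>\<^sup>2 - 1)" for \<omega>
    using exp_scaled_le[OF assms] by simp
qed (use assms in auto)

text \<open>The vector \<open>v\<close> may be unbounded, and then \<open>\<langle>e, v\<rangle>\<close> need not be integrable. But the linear term of
  the pointwise bound is needed only where \<open>\<sigma> \<parallel>v\<parallel> \<le> 1\<close>, and there \<open>v\<close> is bounded.\<close>

lemma nn_cond_exp_exp_inner_le_1:
  assumes v: "v \<in> borel_measurable F"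
    and centred: "\<And>b. b \<in> Basis \<Longrightarrow> AE \<omega> in M. real_cond_exp M F (\<lambda>\<omega>. e \<omega> \<bullet> b) \<omega> = 0"
  shows "AE \<omega> in M. nn_cond_exp M F
    (\<lambda>\<omega>. ennreal (exp (e \<omega> \<bullet> v \<omega> - \<sigma>\<^sup>2 * (norm (v \<omega>))\<^sup>2))) \<omega> \<le> 1"
proof -
  note [measurable] = v measurable_from_subalg[OF subalg v]
  define s where "s \<omega> = \<sigma>\<^sup>2 * (norm (v \<omega>))\<^sup>2" for \<omega>
  (* Where \<sigma> \<parallel>v\<parallel> > 1, the bound of exp_inner_le_large has coefficient 1/2 and no linear term. *)
  define s' where "s' \<omega> = (if s \<omega> \<le> 1 then s \<omega> else 1 / 2)" for \<omega>
  define u where "u \<omega> = (if s \<omega> \<le> 1 then exp (- s \<omega>) *\<^sub>R v \<omega> else 0)" for \<omega>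
  have [measurable]: "s \<in> borel_measurable F"
    unfolding s_def by measurable
  have s'_meas: "s' \<in> borel_measurable F"
    unfolding s'_def by measurable
  have u_meas: "u \<in> borel_measurable F"
    unfolding u_def by measurable
  have u_bound: "norm (u \<omega>) \<le> 1 / \<sigma>" for \<omega>
  proof (cases "s \<omega> \<le> 1")
    case True
    then have "(\<sigma> * norm (v \<omega>))\<^sup>2 \<le> 1\<^sup>2"
      by (simp add: s_def power_mult_distrib)
    then have "\<sigma> * norm (v \<omega>) \<le> 1"
      by (rule power2_le_imp_le) simp
    moreover have "exp (- s \<omega>) * norm (v \<omega>) \<le> norm (v \<omega>)"
      by (intro mult_left_le_one_le) (auto simp: s_def)
    moreover have "norm (u \<omega>) = exp (- s \<omega>) * norm (v \<omega>)"
      using True by (simp add: u_def)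
    ultimately show ?thesis
      using \<sigma> by (simp add: field_simps) (smt (verit) mult_left_mono)
  next
    case False
    then show ?thesis
      using \<sigma> by (simp add: u_def)
  qed
  show ?thesis
  proof (rule real_cond_exp_convex_combination_le[OF subgaussian_normalized(1) _
        subgaussian_normalized(2) _ _ s'_meas])
    show "integrable M (\<lambda>\<omega>. e \<omega> \<bullet> u \<omega>)"
      by (rule integrable_inner_bounded[OF subgaussian_integrable
            measurable_from_subalg[OF subalg u_meas] u_bound])
    show "AE \<omega> in M. real_cond_exp M F (\<lambda>\<omega>. e \<omega> \<bullet> u \<omega>) \<omega> = 0"
      by (rule real_cond_exp_inner_bounded[OF subgaussian_integrable u_meas u_bound centred])
    show "exp (e \<omega> \<bullet> v \<omega> - \<sigma>\<^sup>2 * (norm (v \<omega>))\<^sup>2)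
        \<le> e \<omega> \<bullet> u \<omega> + (1 - s' \<omega>) + s' \<omega> * exp ((norm (e \<omega>))\<^sup>2 / \<sigma>\<^sup>2 - 1)" for \<omega>
    proof (cases "s \<omega> \<le> 1")
      case True
      then show ?thesis
        using exp_inner_le_small[OF \<sigma> s_def, of \<omega> "e \<omega>"] by (simp add: s_def s'_def u_def)
    next
      case False
      then show ?thesis
        using exp_inner_le_large[OF \<sigma> s_def, of \<omega> "e \<omega>"] by (simp add: s_def s'_def u_def)
    qed
  qed (auto simp: s'_def s_def)
qed

end

end

section \<open>A maximal inequality for nonnegative supermartingales\<close>

text \<open>Ville's inequality. The supermartingale property is expressed by a multiplicative increment \<open>R n\<close>
  of conditional mean at most \<open>1\<close>, which is the form in which exponential processes provide it;
  in extended nonnegative reals this requires no integrability. The proof follows the process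
  stopped at the first time it reaches \<open>a\<close>, bounded below by \<open>a\<close> on the event of having stopped.\<close>

lemma (in finite_measure) supermartingale_maximal_inequality:
  fixes Z R :: "nat \<Rightarrow> 'a \<Rightarrow> ennreal" and F :: "nat \<Rightarrow> 'a measure"
  assumes sub: "\<And>n. subalgebra M (F n)" and mono: "\<And>n. sets (F n) \<subseteq> sets (F (Suc n))"
    and Z: "\<And>n. Z n \<in> borel_measurable (F n)"
    and R: "\<And>n. R n \<in> borel_measurable M"
    and step: "\<And>n \<omega>. \<omega> \<in> space M \<Longrightarrow> Z (Suc n) \<omega> \<le> Z n \<omega> * R n \<omega>"
    and R_le: "\<And>n. AE \<omega> in M. nn_cond_exp M (F n) (R n) \<omega> \<le> 1"
  shows "a * emeasure M {\<omega> \<in> space M. \<exists>n. a \<le> Z n \<omega>} \<le> (\<integral>\<^sup>+ \<omega>. Z 0 \<omega> \<partial>M)"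
proof -
  note [measurable] = R
  have Z_M [measurable]: "Z n \<in> borel_measurable M" for n
    by (rule measurable_from_subalg[OF sub Z])
  have space_F: "space (F n) = space M" for n
    using sub by (simp add: subalgebra_def)
  define S where "S n = {\<omega> \<in> space M. \<forall>j\<le>n. Z j \<omega> < a}" for n
  have S_Suc: "S (Suc n) = S n \<inter> {\<omega> \<in> space M. Z (Suc n) \<omega> < a}" for n
    by (auto simp: S_def le_Suc_eq)
  have S_F: "S n \<in> sets (F n)" for n
  proof (induction n)
    case 0
    have "{\<omega> \<in> space (F 0). Z 0 \<omega> < a} \<in> sets (F 0)"
      using Z[of 0] by measurable
    then show ?case
      by (simp add: S_def space_F)
  next
    case (Suc n)
    have "{\<omega> \<in> space (F (Suc n)). Z (Suc n) \<omega> < a} \<in> sets (F (Suc n))"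
      using Z[of "Suc n"] by measurable
    with Suc mono[of n] show ?case
      unfolding S_Suc by (auto simp: space_F)
  qed
  have S_M [measurable]: "S n \<in> sets M" for n
    using S_F[of n] sub[of n] by (auto simp: subalgebra_def)
  (* S n is the event that level a has not been reached by time n, and V n replaces the value
     attained at the stopping time by a. *)
  define V where "V n \<omega> = a * indicator (space M - S n) \<omega> + Z n \<omega> * indicator (S n) \<omega>" for n \<omega>
  have V_le: "(\<integral>\<^sup>+ \<omega>. V n \<omega> \<partial>M) \<le> (\<integral>\<^sup>+ \<omega>. Z 0 \<omega> \<partial>M)" for n
  proof (induction n)
    case 0
    show ?case
      by (rule nn_integral_mono) (auto simp: V_def S_def indicator_def not_less)
  next
    case (Suc n)
    interpret finite_measure_subalgebra M "F n"
      by unfold_locales (rule sub)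
    have W: "(\<lambda>\<omega>. Z n \<omega> * indicator (S n) \<omega>) \<in> borel_measurable (F n)"
      by (intro borel_measurable_times_ennreal borel_measurable_indicator Z S_F)
    have "(\<integral>\<^sup>+ \<omega>. V (Suc n) \<omega> \<partial>M)
        \<le> (\<integral>\<^sup>+ \<omega>. a * indicator (space M - S n) \<omega> + Z n \<omega> * indicator (S n) \<omega> * R n \<omega> \<partial>M)"
    proof (rule nn_integral_mono)
      fix \<omega>
      assume "\<omega> \<in> space M"
      with step[OF this, of n]
      show "V (Suc n) \<omega> \<le> a * indicator (space M - S n) \<omega> + Z n \<omega> * indicator (S n) \<omega> * R n \<omega>"
        by (auto simp: V_def S_Suc indicator_def not_less)
    qed
    also have "\<dots> = (\<integral>\<^sup>+ \<omega>. a * indicator (space M - S n) \<omega> \<partial>M)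
        + (\<integral>\<^sup>+ \<omega>. Z n \<omega> * indicator (S n) \<omega> * R n \<omega> \<partial>M)"
      by (rule nn_integral_add) auto
    also have "(\<integral>\<^sup>+ \<omega>. Z n \<omega> * indicator (S n) \<omega> * R n \<omega> \<partial>M)
        = (\<integral>\<^sup>+ \<omega>. Z n \<omega> * indicator (S n) \<omega> * nn_cond_exp M (F n) (R n) \<omega> \<partial>M)"
      by (rule nn_cond_exp_intg[symmetric, OF W R])
    also have "\<dots> \<le> (\<integral>\<^sup>+ \<omega>. Z n \<omega> * indicator (S n) \<omega> \<partial>M)"
      using R_le[of n]
      by (intro nn_integral_mono_AE, eventually_elim) (metis mult.right_neutral mult_left_mono zero_le)
    also have "(\<integral>\<^sup>+ \<omega>. a * indicator (space M - S n) \<omega> \<partial>M) + \<dots> = (\<integral>\<^sup>+ \<omega>. V n \<omega> \<partial>M)"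
      unfolding V_def by (rule nn_integral_add[symmetric]) auto
    finally show ?case
      using Suc by (auto intro: order_trans add_left_mono)
  qed
  have "a * emeasure M (space M - S n) \<le> (\<integral>\<^sup>+ \<omega>. Z 0 \<omega> \<partial>M)" for n
  proof -
    have "a * emeasure M (space M - S n) = (\<integral>\<^sup>+ \<omega>. a * indicator (space M - S n) \<omega> \<partial>M)"
      by (simp add: nn_integral_cmult_indicator)
    also have "\<dots> \<le> (\<integral>\<^sup>+ \<omega>. V n \<omega> \<partial>M)"
      by (rule nn_integral_mono) (simp add: V_def)
    finally show ?thesis
      using V_le[of n] by simp
  qed
  moreover have "emeasure M {\<omega> \<in> space M. \<exists>n. a \<le> Z n \<omega>} = (SUP n. emeasure M (space M - S n))"
  proof -
    have "{\<omega> \<in> space M. \<exists>n. a \<le> Z n \<omega>} = (\<Union>n. space M - S n)"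
      unfolding S_def not_less[symmetric] by blast
    moreover have "incseq (\<lambda>n. space M - S n)"
      by (rule incseq_SucI) (auto simp: S_Suc)
    ultimately show ?thesis
      by (simp add: SUP_emeasure_incseq image_subset_iff)
  qed
  ultimately show ?thesis
    by (simp add: SUP_mult_left_ennreal SUP_le_iff)
qed

lemma (in prob_space) exponential_supermartingale_bound:
  fixes X r :: "nat \<Rightarrow> 'a \<Rightarrow> real" and F :: "nat \<Rightarrow> 'a measure"
  assumes sub: "\<And>n. subalgebra M (F n)" and mono: "\<And>n. sets (F n) \<subseteq> sets (F (Suc n))"
    and X: "\<And>n. X n \<in> borel_measurable (F n)"
    and r [measurable]: "\<And>n. r n \<in> borel_measurable M"
    and step: "\<And>n \<omega>. \<omega> \<in> space M \<Longrightarrow> X (Suc n) \<omega> \<le> X n \<omega> + r n \<omega>"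
    and r_le: "\<And>n. AE \<omega> in M. nn_cond_exp M (F n) (\<lambda>\<omega>. ennreal (exp (r n \<omega>))) \<omega> \<le> 1"
    and init: "\<And>\<omega>. \<omega> \<in> space M \<Longrightarrow> X 0 \<omega> = c"
    and "\<beta> > 0"
  shows "prob {\<omega> \<in> space M. \<exists>n. c + ln (1 / \<beta>) \<le> X n \<omega>} \<le> \<beta>"
proof -
  define a where "a = exp (c + ln (1 / \<beta>))"
  define bad where "bad = {\<omega> \<in> space M. \<exists>n. c + ln (1 / \<beta>) \<le> X n \<omega>}"
  have "ennreal a * emeasure M {\<omega> \<in> space M. \<exists>n. ennreal a \<le> ennreal (exp (X n \<omega>))}
      \<le> (\<integral>\<^sup>+ \<omega>. ennreal (exp (X 0 \<omega>)) \<partial>M)"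
  proof (rule supermartingale_maximal_inequality[where F = F, OF sub mono])
    show "ennreal (exp (X (Suc n) \<omega>)) \<le> ennreal (exp (X n \<omega>)) * ennreal (exp (r n \<omega>))"
      if "\<omega> \<in> space M" for n \<omega>
      using step[OF that, of n] by (simp add: ennreal_mult[symmetric] exp_add[symmetric])
    show "(\<lambda>\<omega>. ennreal (exp (X n \<omega>))) \<in> borel_measurable (F n)" for n
      using X[of n] by measurable
  qed (use r_le in auto)
  also have "{\<omega> \<in> space M. \<exists>n. ennreal a \<le> ennreal (exp (X n \<omega>))} = bad"
    by (simp add: bad_def a_def)
  also have "(\<integral>\<^sup>+ \<omega>. ennreal (exp (X 0 \<omega>)) \<partial>M) = (\<integral>\<^sup>+ \<omega>. ennreal (exp c) \<partial>M)"
    by (rule nn_integral_cong) (simp add: init)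
  also have "\<dots> = ennreal (exp c)"
    by (simp add: emeasure_space_1)
  finally have "ennreal (a * prob bad) \<le> ennreal (exp c)"
    by (simp add: emeasure_eq_measure a_def ennreal_mult)
  then have "a * prob bad \<le> exp c"
    by simp
  moreover have "a = exp c / \<beta>"
    using \<open>\<beta> > 0\<close> by (simp add: a_def exp_add)
  ultimately show ?thesis
    using \<open>\<beta> > 0\<close> unfolding bad_def[symmetric] by (simp add: field_simps)
qed

section \<open>The filtration of the stochastic gradient iteration\<close>

lemma space_past [simp]: "space (past M N \<xi> k) = space M"
  by (simp add: past_def space_measure_of_conv)

lemma sets_past:
  "sets (past M N \<xi> k)
    = sigma_sets (space M) (\<Union>i\<in>{1..<k}. {\<xi> i -` A \<inter> space M | A. A \<in> sets N})"
  unfolding past_def by (rule sets_measure_of) auto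

lemma subalgebra_past:
  assumes "\<And>i. i \<ge> 1 \<Longrightarrow> \<xi> i \<in> measurable M N"
  shows "subalgebra M (past M N \<xi> k)"
proof -
  have "sigma_sets (space M) (\<Union>i\<in>{1..<k}. {\<xi> i -` A \<inter> space M | A. A \<in> sets N}) \<subseteq> sets M"
    using assms by (intro sets.sigma_sets_subset) (auto intro: measurable_sets)
  then show ?thesis
    by (simp add: subalgebra_def sets_past)
qed

lemma subalgebra_past_mono:
  assumes "j \<le> k"
  shows "subalgebra (past M N \<xi> k) (past M N \<xi> j)"
  unfolding subalgebra_def space_past sets_past
  using assms by (intro conjI refl sigma_sets_mono' UN_mono) auto

lemma measurable_past_sample:
  assumes "1 \<le> i" "i < k" "\<xi> i \<in> measurable M N"
  shows "\<xi> i \<in> measurable (past M N \<xi> k) N"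
proof (rule measurableI)
  show "\<xi> i \<omega> \<in> space N" if "\<omega> \<in> space (past M N \<xi> k)" for \<omega>
    using measurable_space[OF assms(3)] that by simp
  show "\<xi> i -` A \<inter> space (past M N \<xi> k) \<in> sets (past M N \<xi> k)" if "A \<in> sets N" for A
    unfolding space_past sets_past
    using assms that by (intro sigma_sets.Basic UN_I[of i]) auto
qed

lemma borel_measurable_grad:
  fixes f :: "'a::euclidean_space \<Rightarrow> real"
  assumes "smooth_fun L f" "L \<ge> 0"
  shows "grad f \<in> borel_measurable borel"
proof -
  have "L-lipschitz_on UNIV (grad f)"
    using assms by (intro lipschitz_onI) (auto simp: smooth_fun_def dist_norm)
  then show ?thesis
    by (intro borel_measurable_continuous_onI lipschitz_on_continuous_on)
qed

lemma borel_measurable_smooth_fun: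
  fixes f :: "'a::euclidean_space \<Rightarrow> real"
  assumes "smooth_fun L f"
  shows "f \<in> borel_measurable borel"
  using assms unfolding smooth_fun_def
  by (intro borel_measurable_continuous_onI continuous_at_imp_continuous_on)
    (auto intro: differentiable_imp_continuous_within)

text \<open>Conditional expectation of vector components is linear only on integrable functions; linear growth
  of the gradient transfers integrability from the iterates to the gradients.\<close>

lemma (in finite_measure) integrable_grad:
  fixes f :: "'b::euclidean_space \<Rightarrow> real" and X :: "'a \<Rightarrow> 'b"
  assumes "smooth_fun L f" "L \<ge> 0" and X: "integrable M X"
  shows "integrable M (\<lambda>\<omega>. grad f (X \<omega>))"
proof (rule Bochner_Integration.integrable_bound)
  have [measurable]: "X \<in> borel_measurable M"
    using X by simp
  show "(\<lambda>\<omega>. grad f (X \<omega>)) \<in> borel_measurable M"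
    by (rule measurable_compose[OF _ borel_measurable_grad[OF assms(1,2)]]) simp
  show "integrable M (\<lambda>\<omega>. L * norm (X \<omega>) + norm (grad f 0))"
    using X by auto
  have "norm (grad f (X \<omega>)) \<le> L * norm (X \<omega>) + norm (grad f 0)" for \<omega>
  proof -
    have "norm (grad f (X \<omega>) - grad f 0) \<le> L * norm (X \<omega> - 0)"
      using assms(1) unfolding smooth_fun_def by blast
    then show ?thesis
      using norm_triangle_ineq2[of "grad f (X \<omega>)" "grad f 0"] by simp
  qed
  then show "AE \<omega> in M. norm (grad f (X \<omega>)) \<le> norm (L * norm (X \<omega>) + norm (grad f 0))"
    using \<open>L \<ge> 0\<close> by simp
qed

lemma (in finite_measure_subalgebra) vec_cond_exp_centred:
  fixes G H :: "'a \<Rightarrow> real ^ 'n"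
  assumes G: "integrable M G" and H: "integrable M H" "H \<in> borel_measurable F"
    and eq: "AE \<omega> in M. vec_cond_exp M F G \<omega> = H \<omega>" and b: "b \<in> Basis"
  shows "AE \<omega> in M. real_cond_exp M F (\<lambda>\<omega>. (G \<omega> - H \<omega>) \<bullet> b) \<omega> = 0"
proof -
  obtain i where b: "b = axis i 1"
    using b by (auto simp: Basis_vec_def)
  have [measurable]: "(\<lambda>\<omega>. H \<omega> $ i) \<in> borel_measurable F"
    using borel_measurable_inner[OF H(2) borel_measurable_const[of b]]
    by (simp add: b inner_axis)
  have int: "integrable M (\<lambda>\<omega>. G \<omega> $ i)" "integrable M (\<lambda>\<omega>. H \<omega> $ i)"
    using integrable_inner_left[OF G, of b] integrable_inner_left[OF H(1), of b]
    by (simp_all add: b inner_axis)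
  have "AE \<omega> in M. real_cond_exp M F (\<lambda>\<omega>. G \<omega> $ i - H \<omega> $ i) \<omega>
      = real_cond_exp M F (\<lambda>\<omega>. G \<omega> $ i) \<omega> - real_cond_exp M F (\<lambda>\<omega>. H \<omega> $ i) \<omega>"
    by (rule real_cond_exp_diff[OF int])
  moreover have "AE \<omega> in M. real_cond_exp M F (\<lambda>\<omega>. H \<omega> $ i) \<omega> = H \<omega> $ i"
    by (rule real_cond_exp_F_meas[OF int(2)]) measurable
  moreover have "AE \<omega> in M. real_cond_exp M F (\<lambda>\<omega>. G \<omega> $ i) \<omega> = H \<omega> $ i"
    using eq by eventually_elim (auto simp: vec_cond_exp_def vec_eq_iff)
  ultimately have "AE \<omega> in M. real_cond_exp M F (\<lambda>\<omega>. G \<omega> $ i - H \<omega> $ i) \<omega> = 0"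
    by eventually_elim simp
  then show ?thesis
    by (simp add: b inner_axis)
qed

section \<open>Uniform bound along the iteration\<close>

text \<open>The choice \<open>a = a' (1 + \<sigma>\<^sup>2 w)\<close> of the discount factors is the one for which the decrease
  \<open>(a - a') E = a' \<sigma>\<^sup>2 w E\<close> covers the variance proxy \<open>\<sigma>\<^sup>2 \<parallel>v\<parallel>\<^sup>2 \<le> \<sigma>\<^sup>2 a'\<^sup>2 w E\<close>; this needs \<open>a' \<le> 1\<close>.\<close>

lemma discounted_lyapunov_step:
  fixes e v z :: "'a::real_inner"
  assumes discount: "0 \<le> a'" "a' \<le> 1" "a = a' * (1 + \<sigma>\<^sup>2 * w)" and w: "0 \<le> w"
    and z: "(norm z)\<^sup>2 \<le> E" and v: "v = - (a' * sqrt w) *\<^sub>R z"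
    and E': "E' \<le> E + w * (norm e)\<^sup>2 - sqrt w * (e \<bullet> z)"
  shows "a' * E' - w * (norm e)\<^sup>2 \<le> a * E + (e \<bullet> v - \<sigma>\<^sup>2 * (norm v)\<^sup>2)"
proof -
  have E: "0 \<le> E"
    using z zero_le_power2[of "norm z"] by linarith
  have "a' * E' \<le> a' * (E + w * (norm e)\<^sup>2 - sqrt w * (e \<bullet> z))"
    using E' discount by (intro mult_left_mono)
  also have "\<dots> = a' * E + a' * (w * (norm e)\<^sup>2) + e \<bullet> v"
    by (simp add: v algebra_simps)
  also have "a' * (w * (norm e)\<^sup>2) \<le> w * (norm e)\<^sup>2"
    using discount w by (intro mult_left_le_one_le) auto
  finally have "a' * E' - w * (norm e)\<^sup>2 \<le> a' * E + e \<bullet> v"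
    by simp
  moreover have "(norm v)\<^sup>2 \<le> a' * w * E"
  proof -
    have "(norm v)\<^sup>2 = a' * (a' * w * (norm z)\<^sup>2)"
      using w discount by (simp add: v power_mult_distrib power2_eq_square)
    also have "\<dots> \<le> a' * w * (norm z)\<^sup>2"
      using discount w by (intro mult_left_le_one_le) auto
    also have "\<dots> \<le> a' * w * E"
      using discount w z by (intro mult_left_mono) auto
    finally show ?thesis .
  qed
  then have "\<sigma>\<^sup>2 * (norm v)\<^sup>2 \<le> \<sigma>\<^sup>2 * (a' * w * E)"
    by (rule mult_left_mono) simp
  ultimately show ?thesis
    by (simp add: discount(3) algebra_simps)
qed

text \<open>The two estimates of the growth factor are used on different summands, which produces the
  asymmetric shape of the constants.\<close>

lemma growth_bound_le_const:
  assumes "L > 0" "0 \<le> E0" "0 \<le> l"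
    and E: "E / growth L \<sigma> n - T < E0 + l" and T: "T \<le> \<sigma>\<^sup>2 * gamma1 L * (1 + l)"
  shows "L * E \<le> const1 L \<sigma> E0 + const2 L \<sigma> * l"
proof -
  have pos: "growth L \<sigma> n > 0"
    using growth_ge_1[OF assms(1), of \<sigma> n] by linarith
  have "E \<le> growth L \<sigma> n * (E0 + l) + growth L \<sigma> n * T"
    using E pos by (simp add: field_simps)
  also have "\<dots> \<le> gamma2 L \<sigma> * (E0 + l)
      + (1 + \<sigma>\<^sup>2 * gamma1 L * gamma2 L \<sigma>) * (\<sigma>\<^sup>2 * gamma1 L * (1 + l))"
  proof (rule add_mono)
    show "growth L \<sigma> n * (E0 + l) \<le> gamma2 L \<sigma> * (E0 + l)"
      using assms by (intro mult_right_mono growth_le_gamma2) auto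
    have "growth L \<sigma> n * T \<le> growth L \<sigma> n * (\<sigma>\<^sup>2 * gamma1 L * (1 + l))"
      using T pos by (intro mult_left_mono) auto
    also have "\<dots> \<le> (1 + \<sigma>\<^sup>2 * gamma1 L * gamma2 L \<sigma>) * (\<sigma>\<^sup>2 * gamma1 L * (1 + l))"
      using assms gamma1_pos[OF assms(1)] by (intro mult_right_mono growth_le_gronwall) auto
    finally show "growth L \<sigma> n * T
        \<le> (1 + \<sigma>\<^sup>2 * gamma1 L * gamma2 L \<sigma>) * (\<sigma>\<^sup>2 * gamma1 L * (1 + l))" .
  qed
  finally have "L * E \<le> L * (gamma2 L \<sigma> * (E0 + l)
      + (1 + \<sigma>\<^sup>2 * gamma1 L * gamma2 L \<sigma>) * (\<sigma>\<^sup>2 * gamma1 L * (1 + l)))"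
    using assms(1) by (intro mult_left_mono) auto
  also have "\<dots> = const1 L \<sigma> E0 + const2 L \<sigma> * l"
    by (simp add: const1_def const2_def algebra_simps)
  finally show ?thesis .
qed

theorem theorem5:
  fixes f :: "real ^ 'n \<Rightarrow> real"
    and L \<sigma> \<beta> :: real
    and xstar xinit :: "real ^ 'n"
    and M :: "'w measure" and N :: "'b measure"
    and \<xi> :: "nat \<Rightarrow> 'w \<Rightarrow> 'b"
    and g :: "real ^ 'n \<Rightarrow> 'b \<Rightarrow> real ^ 'n"
    and x :: "nat \<Rightarrow> 'w \<Rightarrow> real ^ 'n"
  assumes "L > 0" and "convex_on UNIV f" and "smooth_fun L f"
    and minimizer: "\<And>y. f xstar \<le> f y"
    and "prob_space M"
    and g_meas: "(\<lambda>(y, s). g y s) \<in> borel_measurable (borel \<Otimes>\<^sub>M N)"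
    and xi_meas: "\<And>k. k \<ge> 1 \<Longrightarrow> \<xi> k \<in> measurable M N"
    and init: "\<And>\<omega>. \<omega> \<in> space M \<Longrightarrow> x 0 \<omega> = xinit \<and> x 1 \<omega> = xinit"
    and step: "\<And>k \<omega>. k \<ge> 1 \<Longrightarrow> \<omega> \<in> space M \<Longrightarrow>
      x (k + 1) \<omega> = x k \<omega> + (real k / (real k + 2)) *\<^sub>R (x k \<omega> - x (k - 1) \<omega>)
        - (2 * sqrt (stepsize L k) / ((real k + 2) * sqrt (real k))) *\<^sub>R g (x k \<omega>) (\<xi> k \<omega>)"
    and "\<sigma> > 0"
    and unbiased: "\<And>k. k \<ge> 1 \<Longrightarrow>
      AE \<omega> in M. vec_cond_exp M (past M N \<xi> k) (\<lambda>\<omega>. g (x k \<omega>) (\<xi> k \<omega>)) \<omega> = grad f (x k \<omega>)"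
    and second_moment: "\<And>k. k \<ge> 1 \<Longrightarrow>
      AE \<omega> in M. nn_cond_exp M (past M N \<xi> k) (\<lambda>\<omega>. ennreal ((norm (g (x k \<omega>) (\<xi> k \<omega>)))\<^sup>2)) \<omega>
        \<le> ennreal ((norm (grad f (x k \<omega>)))\<^sup>2 + \<sigma>\<^sup>2)"
    and subgaussian: "\<And>k. k \<ge> 1 \<Longrightarrow>
      AE \<omega> in M. nn_cond_exp M (past M N \<xi> k)
          (\<lambda>\<omega>. ennreal (exp ((norm (g (x k \<omega>) (\<xi> k \<omega>) - grad f (x k \<omega>)))\<^sup>2 / \<sigma>\<^sup>2))) \<omega>
        \<le> ennreal (exp 1)"
    and "\<beta> > 0"
  shows "measure M {\<omega> \<in> space M. \<forall>k. f (x k \<omega>) - f xstar \<le>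
      (const1 L \<sigma> (lyapunov_init L f xstar xinit xinit) + const2 L \<sigma> * ln (1 / \<beta>))
        * ln (real k + 2) / sqrt (real k + 1)} \<ge> 1 - 2 * \<beta>"
proof (cases "\<beta> < 1 / 2")
  case False
  (* The claimed lower bound for the probability is nonpositive. *)
  then show ?thesis
    using measure_nonneg[of M] by (smt (verit) field_sum_of_halves)
next
  case True
  interpret prob_space M
    by fact
  note L = \<open>L > 0\<close> and \<sigma> = \<open>\<sigma> > 0\<close> and \<beta> = \<open>\<beta> > 0\<close> and smooth = \<open>smooth_fun L f\<close>
  define l where "l = ln (1 / \<beta>)"
  define E0 where "E0 = lyapunov_init L f xstar xinit xinit"
  have l: "l \<ge> 0"
    using True \<beta> by (simp add: l_def)
  (* F n makes the iterates up to n + 1 and the errors with index below n measurable; the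
     error e n is produced by sample n + 1, the first one that F n does not contain. *)
  define F where "F n = past M N \<xi> (Suc n)" for n
  define G where "G n \<omega> = g (x (Suc n) \<omega>) (\<xi> (Suc n) \<omega>)" for n \<omega>
  define e where "e n \<omega> = G n \<omega> - grad f (x (Suc n) \<omega>)" for n \<omega>
  define z where "z n \<omega> = x (Suc n) \<omega> + (real n + 1) *\<^sub>R (x (Suc n) \<omega> - x n \<omega>) - xstar" for n \<omega>
  define E where "E n \<omega> = lyapunov L f xstar n (x n \<omega>) (x (Suc n) \<omega>)" for n \<omega>

  have sub_past: "subalgebra M (past M N \<xi> k)" for k
    by (rule subalgebra_past[OF xi_meas])
  have sub: "subalgebra M (F n)" for n
    unfolding F_def by (rule sub_past)
  have mono: "sets (F n) \<subseteq> sets (F (Suc n))" for n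
    using subalgebra_past_mono[of "Suc n" "Suc (Suc n)" M N \<xi>] by (simp add: F_def subalgebra_def)
  have up: "X \<in> borel_measurable (past M N \<xi> k)"
    if "X \<in> borel_measurable (past M N \<xi> j)" "j \<le> k" for X :: "'w \<Rightarrow> real ^ 'n" and j k
    by (rule measurable_from_subalg[OF subalgebra_past_mono[OF that(2)] that(1)])
  have G_past: "(\<lambda>\<omega>. g (X \<omega>) (\<xi> k \<omega>)) \<in> borel_measurable (past M N \<xi> (Suc k))"
    if "k \<ge> 1" "X \<in> borel_measurable (past M N \<xi> k)" for X k
  proof -
    have "(\<lambda>\<omega>. (X \<omega>, \<xi> k \<omega>)) \<in> measurable (past M N \<xi> (Suc k)) (borel \<Otimes>\<^sub>M N)"
      using that xi_meas
      by (intro measurable_Pair measurable_past_sample up[OF that(2)]) auto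
    from measurable_compose[OF this g_meas] show ?thesis
      by simp
  qed
  have x_past: "x k \<in> borel_measurable (past M N \<xi> k)" for k
  proof (induction k rule: less_induct)
    case (less k)
    show ?case
    proof (cases "k \<le> 1")
      case True
      then have "k = 0 \<or> k = 1"
        by linarith
      then have eq: "x k \<omega> = xinit" if "\<omega> \<in> space (past M N \<xi> k)" for \<omega>
        using init that by auto
      show ?thesis
        by (subst measurable_cong[OF eq]) simp_all
    next
      case False
      then obtain m where k: "k = Suc (Suc m)"
        by (metis One_nat_def Suc_le_mono le0 not0_implies_Suc)
      define j where "j = Suc m"
      have [measurable]: "x j \<in> borel_measurable (past M N \<xi> k)"
        "x (j - 1) \<in> borel_measurable (past M N \<xi> k)"
        by (rule up[OF less[of j]] up[OF less[of "j - 1"]]; simp add: k j_def)+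
      have [measurable]: "(\<lambda>\<omega>. g (x j \<omega>) (\<xi> j \<omega>)) \<in> borel_measurable (past M N \<xi> k)"
        using G_past[of j "x j"] less[of j] by (simp add: k j_def)
      have eq: "x k \<omega> = x j \<omega> + (real j / (real j + 2)) *\<^sub>R (x j \<omega> - x (j - 1) \<omega>)
          - (2 * sqrt (stepsize L j) / ((real j + 2) * sqrt (real j))) *\<^sub>R g (x j \<omega>) (\<xi> j \<omega>)"
        if "\<omega> \<in> space (past M N \<xi> k)" for \<omega>
        using step[of j \<omega>] that by (simp add: k j_def)
      show ?thesis
        by (subst measurable_cong[OF eq]) measurable
    qed
  qed
  have x_F: "x (Suc n) \<in> borel_measurable (F n)" "x n \<in> borel_measurable (F n)" for n
    using x_past[of "Suc n"] up[OF x_past[of n], of "Suc n"] by (simp_all add: F_def)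
  have G_F: "G n \<in> borel_measurable (F (Suc n))" for n
    using G_past[OF _ x_past, of "Suc n"] by (simp add: F_def G_def[abs_def])
  have grad_meas: "(\<lambda>\<omega>. grad f (X \<omega>)) \<in> borel_measurable A" if "X \<in> borel_measurable A" for X A
    using measurable_compose[OF that borel_measurable_grad[OF smooth]] L by simp
  have f_meas: "(\<lambda>\<omega>. f (X \<omega>)) \<in> borel_measurable A" if "X \<in> borel_measurable A" for X A
    using measurable_compose[OF that borel_measurable_smooth_fun[OF smooth]] by simp
  have e_F: "e n \<in> borel_measurable (F (Suc n))" for n
    unfolding e_def using G_F[of n] grad_meas[OF x_F(2)[of "Suc n"]] by measurable
  have F_M: "X \<in> borel_measurable M" if "X \<in> borel_measurable (F n)" for n and X :: "'w \<Rightarrow> 'c::topological_space"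
    by (rule measurable_from_subalg[OF sub that])
  have e_M [measurable]: "e n \<in> borel_measurable M" for n
    by (rule F_M[OF e_F])
  have e_subgaussian: "AE \<omega> in M. nn_cond_exp M (F n)
      (\<lambda>\<omega>. ennreal (exp ((norm (e n \<omega>))\<^sup>2 / \<sigma>\<^sup>2))) \<omega> \<le> ennreal (exp 1)" for n
    using subgaussian[of "Suc n"] by (simp add: F_def e_def G_def)
  have fms: "finite_measure_subalgebra M (F n)" for n
    by unfold_locales (rule sub)
  have e_int: "integrable M (e n)" for n
    by (rule finite_measure_subalgebra.subgaussian_integrable[OF fms e_M \<sigma> e_subgaussian])
  (* By induction, since every step adds only a gradient at an integrable point and an
     integrable error; without it, the unbiasedness hypothesis could not be split by linearity. *)
  have x_int: "integrable M (x k)" for k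
  proof (induction k rule: less_induct)
    case (less k)
    show ?case
    proof (cases "k \<le> 1")
      case True
      then have "k = 0 \<or> k = 1"
        by linarith
      then have eq: "x k \<omega> = xinit" if "\<omega> \<in> space M" for \<omega>
        using init that by auto
      show ?thesis
        by (subst Bochner_Integration.integrable_cong[OF refl eq]) simp_all
    next
      case False
      then obtain m where k: "k = Suc (Suc m)"
        by (metis One_nat_def Suc_le_mono le0 not0_implies_Suc)
      define j where "j = Suc m"
      have int: "integrable M (x j)" "integrable M (x (j - 1))"
        using less[of j] less[of "j - 1"] by (auto simp: k j_def)
      have "integrable M (\<lambda>\<omega>. grad f (x j \<omega>))"
        using integrable_grad[OF smooth _ int(1)] L by simp
      with int e_int have "integrable M (\<lambda>\<omega>. x j \<omega> + (real j / (real j + 2)) *\<^sub>R (x j \<omega> - x (j - 1) \<omega>)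
          - (2 * sqrt (stepsize L j) / ((real j + 2) * sqrt (real j))) *\<^sub>R (e m \<omega> + grad f (x j \<omega>)))"
        by (intro Bochner_Integration.integrable_diff Bochner_Integration.integrable_add
            integrable_scaleR_right)
      moreover have "x k \<omega> = x j \<omega> + (real j / (real j + 2)) *\<^sub>R (x j \<omega> - x (j - 1) \<omega>)
          - (2 * sqrt (stepsize L j) / ((real j + 2) * sqrt (real j))) *\<^sub>R (e m \<omega> + grad f (x j \<omega>))"
        if "\<omega> \<in> space M" for \<omega>
        using step[of j \<omega>] that by (simp add: k j_def e_def G_def)
      ultimately show ?thesis
        by (subst Bochner_Integration.integrable_cong[OF refl])
    qed
  qed
  have centred: "AE \<omega> in M. real_cond_exp M (F n) (\<lambda>\<omega>. e n \<omega> \<bullet> b) \<omega> = 0" if "b \<in> Basis" for n b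
  proof -
    have grad_int: "integrable M (\<lambda>\<omega>. grad f (x (Suc n) \<omega>))"
      using integrable_grad[OF smooth _ x_int] L by simp
    have "integrable M (\<lambda>\<omega>. e n \<omega> + grad f (x (Suc n) \<omega>))"
      using e_int grad_int by simp
    then have G_int: "integrable M (G n)"
      by (simp add: e_def)
    have "AE \<omega> in M. vec_cond_exp M (F n) (G n) \<omega> = grad f (x (Suc n) \<omega>)"
      using unbiased[of "Suc n"] by (simp add: F_def G_def[abs_def])
    from finite_measure_subalgebra.vec_cond_exp_centred[OF fms G_int grad_int
        grad_meas[OF x_F(1)] this that]
    show ?thesis
      by (simp add: e_def)
  qed

  (* exp (X n) is the supermartingale that controls the Lyapunov function up to the accumulated
     squared errors T n. *)
  define a where "a n = 1 / growth L \<sigma> n" for n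
  define v where "v n \<omega> = - (a (Suc n) * sqrt (noise_weight L n)) *\<^sub>R z n \<omega>" for n \<omega>
  define T where "T n \<omega> = (\<Sum>j<n. noise_weight L j * (norm (e j \<omega>))\<^sup>2)" for n \<omega>
  define X where "X n \<omega> = a n * E n \<omega> - T n \<omega>" for n \<omega>
  have e_past: "e j \<in> borel_measurable (F n)" if "j < n" for j n
    unfolding F_def by (rule up[OF e_F[unfolded F_def]]) (use that in simp)
  have z_F: "z n \<in> borel_measurable (F n)" for n
    unfolding z_def using x_F[of n] by measurable
  have v_F: "v n \<in> borel_measurable (F n)" for n
    unfolding v_def using z_F[of n] by measurable
  have E_F: "E n \<in> borel_measurable (F n)" for n
    unfolding E_def lyapunov_def using x_F[of n] f_meas[OF x_F(2)[of n]] by measurable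
  have T_F: "T n \<in> borel_measurable (F n)" for n
  proof -
    have "(\<lambda>\<omega>. noise_weight L j * (norm (e j \<omega>))\<^sup>2) \<in> borel_measurable (F n)" if "j < n" for j
      using e_past[OF that] by measurable
    then show ?thesis
      unfolding T_def by (intro borel_measurable_sum) auto
  qed
  have "prob {\<omega> \<in> space M. \<exists>n. E0 + ln (1 / \<beta>) \<le> X n \<omega>} \<le> \<beta>"
  proof (rule exponential_supermartingale_bound[where F = F and
        r = "\<lambda>n \<omega>. e n \<omega> \<bullet> v n \<omega> - \<sigma>\<^sup>2 * (norm (v n \<omega>))\<^sup>2", OF sub mono])
    show "X n \<in> borel_measurable (F n)" for n
      unfolding X_def using E_F[of n] T_F[of n] by measurable
    show "(\<lambda>\<omega>. e n \<omega> \<bullet> v n \<omega> - \<sigma>\<^sup>2 * (norm (v n \<omega>))\<^sup>2) \<in> borel_measurable M" for n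
      using F_M[OF v_F[of n]] by measurable
    show "X (Suc n) \<omega> \<le> X n \<omega> + (e n \<omega> \<bullet> v n \<omega> - \<sigma>\<^sup>2 * (norm (v n \<omega>))\<^sup>2)"
      if \<omega>: "\<omega> \<in> space M" for n \<omega>
    proof -
      have grow: "growth L \<sigma> (Suc n) \<ge> 1" "growth L \<sigma> n \<ge> 1"
        by (rule growth_ge_1[OF L])+
      have w: "0 \<le> noise_weight L n"
        using noise_weight_pos[OF L] by (rule less_imp_le)
      have a_eq: "a n = a (Suc n) * (1 + \<sigma>\<^sup>2 * noise_weight L n)"
      proof -
        have "1 + \<sigma>\<^sup>2 * noise_weight L n \<noteq> 0"
          using w by (smt (verit) mult_nonneg_nonneg zero_le_power2)
        then show ?thesis
          using grow by (simp add: a_def growth_Suc)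
      qed
      have "a (Suc n) * E (Suc n) \<omega> - noise_weight L n * (norm (e n \<omega>))\<^sup>2
          \<le> a n * E n \<omega> + (e n \<omega> \<bullet> v n \<omega> - \<sigma>\<^sup>2 * (norm (v n \<omega>))\<^sup>2)"
      proof (rule discounted_lyapunov_step[OF _ _ a_eq w _ v_def])
        show "0 \<le> a (Suc n)" "a (Suc n) \<le> 1"
          using grow by (simp_all add: a_def)
        show "(norm (z n \<omega>))\<^sup>2 \<le> E n \<omega>"
          unfolding z_def E_def by (rule norm_le_lyapunov[where f = f, OF minimizer L])
        have "x (Suc (Suc n)) \<omega> = x (Suc n) \<omega>
            + (real (Suc n) / (real (Suc n) + 2)) *\<^sub>R (x (Suc n) \<omega> - x n \<omega>)
            - (2 * sqrt (stepsize L (Suc n)) / ((real (Suc n) + 2) * sqrt (real (Suc n)))) *\<^sub>R G n \<omega>"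
          using step[of "Suc n" \<omega>] \<omega> by (simp add: G_def)
        from lyapunov_step[where f = f and xstar = xstar, OF L \<open>convex_on UNIV f\<close> smooth minimizer refl this]
        show "E (Suc n) \<omega> \<le> E n \<omega> + noise_weight L n * (norm (e n \<omega>))\<^sup>2
            - sqrt (noise_weight L n) * (e n \<omega> \<bullet> z n \<omega>)"
          by (simp add: E_def e_def z_def add.commute)
      qed
      then show ?thesis
        by (simp add: X_def T_def)
    qed
    show "AE \<omega> in M. nn_cond_exp M (F n)
        (\<lambda>\<omega>. ennreal (exp (e n \<omega> \<bullet> v n \<omega> - \<sigma>\<^sup>2 * (norm (v n \<omega>))\<^sup>2))) \<omega> \<le> 1" for n
      by (rule finite_measure_subalgebra.nn_cond_exp_exp_inner_le_1[OF fms e_M \<sigma>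
            e_subgaussian v_F centred])
    show "X 0 \<omega> = E0" if "\<omega> \<in> space M" for \<omega>
      using init[OF that] by (simp add: X_def T_def a_def growth_def E_def E0_def lyapunov_0)
  qed fact

  (* exp (Y n) is the supermartingale that controls the squared errors themselves. Normalising the
     weights by their total keeps every exponent coefficient within [0, 1]. *)
  moreover define p where "p j = noise_weight L j / gamma1 L" for j
  define Y where "Y n \<omega> = (\<Sum>j<n. p j * ((norm (e j \<omega>))\<^sup>2 / \<sigma>\<^sup>2 - 1))" for n \<omega>
  have \<gamma>: "gamma1 L > 0"
    by (rule gamma1_pos[OF L])
  have p_nonneg: "0 \<le> p j" for j
    using \<gamma> noise_weight_pos[OF L, of j] by (simp add: p_def)
  have p_sum: "(\<Sum>j<n. p j) \<le> 1" for n
    using sum_noise_weight_le_gamma1[OF L, of n] \<gamma>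
    by (simp add: p_def sum_divide_distrib[symmetric])
  have p_le: "p j \<le> 1" for j
    using p_sum[of "Suc j"] sum_nonneg[of "{..<j}" p] p_nonneg by simp
  have "prob {\<omega> \<in> space M. \<exists>n. 0 + ln (1 / \<beta>) \<le> Y n \<omega>} \<le> \<beta>"
  proof (rule exponential_supermartingale_bound[where F = F and
        r = "\<lambda>n \<omega>. p n * ((norm (e n \<omega>))\<^sup>2 / \<sigma>\<^sup>2 - 1)", OF sub mono])
    show "Y n \<in> borel_measurable (F n)" for n
    proof -
      have "(\<lambda>\<omega>. p j * ((norm (e j \<omega>))\<^sup>2 / \<sigma>\<^sup>2 - 1)) \<in> borel_measurable (F n)" if "j < n" for j
        using e_past[OF that] by measurable
      then show ?thesis
        unfolding Y_def by (intro borel_measurable_sum) auto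
    qed
    show "AE \<omega> in M. nn_cond_exp M (F n)
        (\<lambda>\<omega>. ennreal (exp (p n * ((norm (e n \<omega>))\<^sup>2 / \<sigma>\<^sup>2 - 1)))) \<omega> \<le> 1" for n
      by (rule finite_measure_subalgebra.nn_cond_exp_exp_square_le_1[OF fms e_M \<sigma>
            e_subgaussian p_nonneg p_le])
  qed (use \<beta> in \<open>auto simp: Y_def\<close>)

  moreover define badX where "badX = {\<omega> \<in> space M. \<exists>n. E0 + ln (1 / \<beta>) \<le> X n \<omega>}"
  moreover define badY where "badY = {\<omega> \<in> space M. \<exists>n. 0 + ln (1 / \<beta>) \<le> Y n \<omega>}"
  ultimately have "prob badX \<le> \<beta>" "prob badY \<le> \<beta>"
    by simp_all
  have [measurable]: "X n \<in> borel_measurable M" "Y n \<in> borel_measurable M" "x n \<in> borel_measurable M"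
    for n
  proof -
    show "x n \<in> borel_measurable M"
      by (rule F_M[OF x_F(2)])
    show "X n \<in> borel_measurable M"
      unfolding X_def using F_M[OF E_F[of n]] F_M[OF T_F[of n]] by measurable
    show "Y n \<in> borel_measurable M"
      unfolding Y_def by measurable
  qed
  have [measurable]: "badX \<in> events" "badY \<in> events"
    unfolding badX_def badY_def by measurable
  define good where "good = {\<omega> \<in> space M. \<forall>k. f (x k \<omega>) - f xstar
      \<le> (const1 L \<sigma> E0 + const2 L \<sigma> * l) * ln (real k + 2) / sqrt (real k + 1)}"
  have [measurable]: "(\<lambda>\<omega>. f (x k \<omega>)) \<in> borel_measurable M" for k
    by (rule f_meas) simp
  have good_meas [measurable]: "good \<in> events"
    unfolding good_def by measurable
  have "space M - good \<subseteq> badX \<union> badY"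
  proof (rule subsetI, rule ccontr)
    fix \<omega>
    assume \<omega>: "\<omega> \<in> space M - good" and not_bad: "\<omega> \<notin> badX \<union> badY"
    have "f (x k \<omega>) - f xstar
      \<le> (const1 L \<sigma> E0 + const2 L \<sigma> * l) * ln (real k + 2) / sqrt (real k + 1)" for k
    proof -
      have X_less: "E k \<omega> / growth L \<sigma> k - T k \<omega> < E0 + l"
        using not_bad \<omega> by (auto simp: badX_def X_def a_def l_def not_le)
      have "(\<Sum>j<k. p j * ((norm (e j \<omega>))\<^sup>2 / \<sigma>\<^sup>2)) - (\<Sum>j<k. p j) < l"
        using not_bad \<omega>
        by (auto simp: badY_def Y_def l_def not_le right_diff_distrib sum_subtractf)
      with p_sum[of k] have "(\<Sum>j<k. p j * ((norm (e j \<omega>))\<^sup>2 / \<sigma>\<^sup>2)) \<le> 1 + l"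
        by simp
      then have "\<sigma>\<^sup>2 * gamma1 L * (\<Sum>j<k. p j * ((norm (e j \<omega>))\<^sup>2 / \<sigma>\<^sup>2)) \<le> \<sigma>\<^sup>2 * gamma1 L * (1 + l)"
        using \<gamma> by (intro mult_left_mono) auto
      moreover have "\<sigma>\<^sup>2 * gamma1 L * (\<Sum>j<k. p j * ((norm (e j \<omega>))\<^sup>2 / \<sigma>\<^sup>2)) = T k \<omega>"
        using \<gamma> \<sigma> by (simp add: T_def p_def sum_distrib_left)
      ultimately have T_le: "T k \<omega> \<le> \<sigma>\<^sup>2 * gamma1 L * (1 + l)"
        by simp
      have "0 \<le> (norm (xinit + (real 0 + 1) *\<^sub>R (xinit - xinit) - xstar))\<^sup>2"
        by simp
      also have "\<dots> \<le> E0"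
        unfolding E0_def lyapunov_0[symmetric] by (rule norm_le_lyapunov[where f = f, OF minimizer L])
      finally have "L * E k \<omega> \<le> const1 L \<sigma> E0 + const2 L \<sigma> * l"
        by (intro growth_bound_le_const[OF L _ l X_less T_le])
      then have "L * E k \<omega> * ln (real k + 2) / sqrt (real k + 1)
          \<le> (const1 L \<sigma> E0 + const2 L \<sigma> * l) * ln (real k + 2) / sqrt (real k + 1)"
        by (intro divide_right_mono mult_right_mono) auto
      moreover have "f (x k \<omega>) - f xstar \<le> L * E k \<omega> * ln (real k + 2) / sqrt (real k + 1)"
        unfolding E_def by (rule suboptimality_le_lyapunov[OF L])
      ultimately show ?thesis
        by linarith
    qed
    then have "\<omega> \<in> good"
      using \<omega> by (simp add: good_def)
    with \<omega> show False
      by simp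
  qed
  then have "prob (space M - good) \<le> prob (badX \<union> badY)"
    by (intro finite_measure_mono) auto
  also have "\<dots> \<le> prob badX + prob badY"
    by (rule measure_Un_le) auto
  also have "\<dots> \<le> 2 * \<beta>"
    using \<open>prob badX \<le> \<beta>\<close> \<open>prob badY \<le> \<beta>\<close> by simp
  finally have "1 - 2 * \<beta> \<le> prob good"
    by (simp add: prob_compl)
  then show ?thesis
    by (simp add: good_def E0_def l_def)
qed

end
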